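(* Fix an integer $k\ge 2$ and a formal variable $q$. Define formal series $G_s$, $s\ge1$, by $$G_i=\prod_{\substack{n\ge 1\\ n\not\equiv 0,\,\pm(k+1-i)\ (\mathrm{mod}\ 2k+1)}}\frac{1}{1-q^n}\quad (i=1,\dots,k),$$ $$G_{(k-1)j+i}=\frac{G_{(k-1)(j-1)+k-i+1}-G_{(k-1)(j-1)+k-i+2}}{q^{(i-1)j}}\quad (j\ge 1,\ i=2,\dots,k).$$ For $j\ge1$ let $\mathbf{A}_{(j)}$ be the $k\times k$ matrix whose $(r,c)$ entry is $q^{(c-1)j}$ if $r+c\le k+1$ and $0$ otherwise, and let $({}_ih^{(j)}_l)_{1\le i,l\le k}=\mathbf{A}_{(1)}\cdots\mathbf{A}_{(j)}$. Then for every $j\ge 1$ and $i=1,\dots,k$, $$G_i=\sum_{l=1}^k {}_ih^{(j)}_l\,G_{(k-1)j+l},$$ and for each $l=1,\dots,k$ the summand ${}_ih^{(j)}_l\,G_{(k-1)j+l}$ is the generating function $\sum_{m\ge0}e(m)q^m$, where $e(m)$ is the number of partitions of $m$ that have difference at least 2 at distance $k-1$, in which $1$ appears at most $k-i$ times, and in which the part $j$ appears exactly $l-1$ times. That is, this expression of $G_i$ is its decomposition according to the number of times $0,1,\dots,k-1$ that the part $j$ appears in a partition.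
   Context: A partition $m=p_1+\cdots+p_n$ with $p_1\ge\cdots\ge p_n>0$ has difference at least 2 at distance $t$ if $p_s-p_{s+t}\ge 2$ whenever $s\ge 1$ and $s+t\le n$. The empty partition of $0$ is included. *)

theory Defs
  imports "HOL-Analysis.Analysis" "HOL-Computational_Algebra.Computational_Algebra"
    "HOL-Number_Theory.Cong" "Jordan_Normal_Form.Matrix"
begin

text \<open>
  The infinite product is taken in the usual (coefficientwise) topology on power series;
  the \<open>n\<close>-th factor is the one for the exponent \<open>n + 1\<close>.
\<close>

definition gordon_factor :: "nat \<Rightarrow> nat \<Rightarrow> nat \<Rightarrow> 'a::field_char_0 fps" where
  "gordon_factor k i n =
    (if [int n = 0] (mod (2 * int k + 1))
        \<or> [int n = int k + 1 - int i] (mod (2 * int k + 1))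
        \<or> [int n = - (int k + 1 - int i)] (mod (2 * int k + 1))
     then 1 else 1 / (1 - fps_X ^ n))"

definition gordon_product :: "nat \<Rightarrow> nat \<Rightarrow> 'a::field_char_0 fps" where
  "gordon_product k i = prodinf (\<lambda>n. gordon_factor k i (Suc n))"

lemma gordon_factor_has_prod:
  "(\<lambda>n. gordon_factor k i (Suc n)) has_prod (gordon_product k i :: 'a::field_char_0 fps)"
proof -
  let ?f = "\<lambda>n. gordon_factor k i (Suc n) :: 'a fps"
  let ?P = "\<lambda>N. \<Prod>n\<le>N. ?f n"
  have low: "fps_nth (?f n) m = (if m = 0 then 1 else 0)" if "m \<le> n" for n m
  proof -
    have "fps_nth (inverse (1 - fps_X ^ Suc n) :: 'a fps) m = (if m = 0 then 1 else 0)"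
    proof -
      have 1: "inverse (1 - fps_X ^ Suc n) * (1 - fps_X ^ Suc n) = (1 :: 'a fps)"
        by (rule inverse_mult_eq_1) simp
      hence "inverse (1 - fps_X ^ Suc n) = (1 :: 'a fps)
               + inverse (1 - fps_X ^ Suc n) * fps_X ^ Suc n"
        by (simp add: algebra_simps)
      hence "fps_nth (inverse (1 - fps_X ^ Suc n) :: 'a fps) m
             = fps_nth (1 + inverse (1 - fps_X ^ Suc n) * fps_X ^ Suc n) m"
        by (rule arg_cong)
      also have "\<dots> = (if m = 0 then 1 else 0)"
        using that by (simp add: fps_X_power_mult_right_nth del: power_Suc)
      finally show ?thesis .
    qed
    thus ?thesis
      by (auto simp: gordon_factor_def fps_divide_unit simp del: power_Suc)
  qed
  have step: "fps_nth (?P (Suc N)) m = fps_nth (?P N) m" if "m \<le> N" for N m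
  proof -
    have "fps_nth (?P (Suc N)) m = (\<Sum>l=0..m. fps_nth (?P N) l * fps_nth (?f (Suc N)) (m - l))"
      by (simp add: fps_mult_nth)
    also have "\<dots> = (\<Sum>l=0..m. if l = m then fps_nth (?P N) l else 0)"
      using that by (intro sum.cong) (auto simp: low)
    finally show ?thesis by simp
  qed
  have stable: "fps_nth (?P N) m = fps_nth (?P m) m" if "m \<le> N" for N m
    using that by (induction rule: dec_induct) (simp_all only: step)
  define L where "L = Abs_fps (\<lambda>m. fps_nth (?P m) m)"
  have conv: "?P \<longlonglongrightarrow> L"
  proof (rule tendsto_fpsI)
    fix m
    show "\<forall>\<^sub>F N in sequentially. fps_nth (?P N) m = fps_nth L m"
      using eventually_ge_at_top[of m] by eventually_elim (unfold L_def fps_nth_Abs_fps, rule stable)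
  qed
  have L0: "L \<noteq> 0"
  proof -
    have "fps_nth L 0 = 1" by (simp add: L_def low)
    thus ?thesis by auto
  qed
  have "raw_has_prod ?f 0 L" using conv L0 unfolding raw_has_prod_def add_0_right by blast
  hence has: "?f has_prod L" unfolding has_prod_def by blast
  have nz: "?f n \<noteq> 0" for n using low[of 0 n] by auto
  have "p = L" if "?f has_prod p" for p
  proof -
    have "(\<lambda>N. \<Prod>n\<le>N. ?f (n + 0)) \<longlonglongrightarrow> p"
      using that nz unfolding has_prod_def raw_has_prod_def by blast
    thus ?thesis using conv unfolding add_0_right by (rule LIMSEQ_unique)
  qed
  hence "prodinf ?f = L" unfolding prodinf_def using has by (intro the_equality)
  thus ?thesis using has unfolding gordon_product_def by simp
qed

text \<open>
  Formal Laurent series are used so that the division by a power of \<open>q\<close> is a genuine division.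
  Every \<open>s > k\<close> is uniquely \<open>(k - 1) * j + i\<close> with \<open>j \<ge> 1\<close> and \<open>2 \<le> i \<le> k\<close>, namely with the
  \<open>j\<close> and \<open>i\<close> below.  The values for \<open>k < 2\<close> or \<open>s = 0\<close> carry no meaning.
\<close>

function gordon_G :: "nat \<Rightarrow> nat \<Rightarrow> 'a::field_char_0 fls" where
  "gordon_G k s =
    (if k < 2 \<or> s \<le> k then fps_to_fls (gordon_product k s)
     else let j = (s - 2) div (k - 1); i = (s - 2) mod (k - 1) + 2 in
       (gordon_G k ((k - 1) * (j - 1) + k - i + 1) - gordon_G k ((k - 1) * (j - 1) + k - i + 2))
         / fls_X ^ ((i - 1) * j))"
  by auto
termination
proof (relation "Wellfounded.measure snd")
  show "wf (Wellfounded.measure snd :: ((nat \<times> nat) \<times> _) set)" by simp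
  have aux: "(k - 1) * (j - 1) + k - i + 2 < s"
    if "\<not> (k < 2 \<or> s \<le> k)" "j = (s - 2) div (k - 1)" "i = (s - 2) mod (k - 1) + 2"
    for k s j i :: nat
  proof -
    have "s - 2 = (k - 1) * j + (s - 2) mod (k - 1)" using that(2) by simp
    hence s: "s = (k - 1) * j + i" using that(1,3) by linarith
    have "i \<le> k" using that mod_less_divisor[of "k - 1" "s - 2"] by linarith
    have "j \<noteq> 0" using that by (auto simp: div_eq_0_iff)
    then obtain j' where j': "j = Suc j'" by (cases j) auto
    have "2 \<le> i" using that by simp
    thus ?thesis using \<open>i \<le> k\<close> unfolding s j' by simp
  qed
  show "((k, (k - 1) * (j - 1) + k - i + 1), k, s) \<in> Wellfounded.measure snd"
    if "\<not> (k < 2 \<or> s \<le> k)" "j = (s - 2) div (k - 1)" "i = (s - 2) mod (k - 1) + 2"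
    for k s j i :: nat
    using aux[OF that] by simp
  show "((k, (k - 1) * (j - 1) + k - i + 2), k, s) \<in> Wellfounded.measure snd"
    if "\<not> (k < 2 \<or> s \<le> k)" "j = (s - 2) div (k - 1)" "i = (s - 2) mod (k - 1) + 2"
    for k s j i :: nat
    using aux[OF that] by simp
qed

declare gordon_G.simps [simp del]

lemma gordon_G_base:
  assumes "i \<le> k"
  shows "gordon_G k i = fps_to_fls (gordon_product k i)"
  using assms by (subst gordon_G.simps) simp

lemma gordon_G_rec:
  assumes "j \<ge> 1" "2 \<le> i" "i \<le> k"
  shows "gordon_G k ((k - 1) * j + i) =
    (gordon_G k ((k - 1) * (j - 1) + k - i + 1) - gordon_G k ((k - 1) * (j - 1) + k - i + 2))
      / fls_X ^ ((i - 1) * j)"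
proof -
  let ?s = "(k - 1) * j + i"
  have s: "?s - 2 = (k - 1) * j + (i - 2)" using assms by simp
  have k: "i - 2 < k - 1" using assms by linarith
  have d: "(?s - 2) div (k - 1) = j" "(?s - 2) mod (k - 1) + 2 = i"
    using k assms(2) by (simp_all only: s mod_mult_self4 div_mult_self4 mod_less div_less)
  have "k - 1 \<le> (k - 1) * j" using assms(1) by simp
  hence "\<not> (k < 2 \<or> ?s \<le> k)" using assms by linarith
  thus ?thesis by (subst gordon_G.simps) (simp only: d Let_def if_False)
qed

text \<open>Row and column indices of matrices start at \<open>0\<close>.\<close>

definition gordon_A :: "nat \<Rightarrow> nat \<Rightarrow> 'a::field_char_0 fls mat" where
  "gordon_A k j =
    mat k k (\<lambda>(r, c). if Suc r + Suc c \<le> k + 1 then fls_X ^ (c * j) else 0)"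

fun gordon_A_prod :: "nat \<Rightarrow> nat \<Rightarrow> 'a::field_char_0 fls mat" where
  "gordon_A_prod k 0 = 1\<^sub>m k"
| "gordon_A_prod k (Suc j) = gordon_A_prod k j * gordon_A k (Suc j)"

definition gordon_h :: "nat \<Rightarrow> nat \<Rightarrow> nat \<Rightarrow> nat \<Rightarrow> 'a::field_char_0 fls" where
  "gordon_h k j i l = gordon_A_prod k j $$ (i - 1, l - 1)"

definition is_partition :: "nat \<Rightarrow> nat list \<Rightarrow> bool" where
  "is_partition m ps \<longleftrightarrow> sorted_wrt (\<ge>) ps \<and> 0 \<notin> set ps \<and> sum_list ps = m"

definition diff2_at_distance :: "nat \<Rightarrow> nat list \<Rightarrow> bool" where
  "diff2_at_distance t ps \<longleftrightarrow> (\<forall>s. s + t < length ps \<longrightarrow> ps ! s \<ge> ps ! (s + t) + 2)"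

lemma finite_partitions: "finite {ps. is_partition m ps}"
proof (rule finite_subset)
  have len: "length ps \<le> sum_list ps" if "0 \<notin> set ps" for ps :: "nat list"
    using that by (induction ps) auto
  show "{ps. is_partition m ps} \<subseteq> {ps. set ps \<subseteq> {..m} \<and> length ps \<le> m}"
    using len by (auto simp: is_partition_def member_le_sum_list)
  show "finite {ps. set ps \<subseteq> {..m} \<and> length ps \<le> m}"
    by (rule finite_lists_length_le) simp
qed

definition gen_fun :: "(nat list \<Rightarrow> bool) \<Rightarrow> 'a::field_char_0 fls" where
  "gen_fun P = fps_to_fls (Abs_fps (\<lambda>m. of_nat (card {ps. is_partition m ps \<and> P ps})))"

end

theory Submission
  imports Defs
begin

text \<open>
  Let \<open>C j i\<close> be the generating function of the partitions into parts \<open>> j\<close> with difference at least 2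
  at distance \<open>k - 1\<close> in which \<open>j + 1\<close> appears fewer than \<open>i\<close> times.  A weakly decreasing list has
  difference at least 2 at distance \<open>t\<close> iff the multiplicities of \<open>v\<close> and \<open>v + 1\<close> sum to at most \<open>t\<close>
  for every \<open>v\<close>; sorting by the multiplicity of \<open>j + 1\<close> therefore gives
  \<open>C j (i + 1) - C j i = q ^ ((j + 1) * i) * C (j + 1) (k - i)\<close>.  Together with \<open>C j 0 = 0\<close> and
  \<open>C j i = 1 + O(q ^ (j + 1))\<close> this recurrence has only one solution.  Andrews' alternating series
  (\<open>gordon_numer\<close>) divided by \<open>\<Prod>n\<ge>1. 1 - q ^ n\<close> is another solution, and for \<open>j = 0\<close> the Jacobi
  triple product turns it into Gordon's product.  Hence the \<open>G\<close> of the statement with index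
  \<open>(k - 1) * j + l\<close> is \<open>C j (k + 1 - l)\<close>, and cutting a partition after its parts \<open>> j\<close> identifies the
  entries of the matrix product with the generating functions of the remaining parts \<open>\<le> j\<close>.
\<close>

subsection \<open>Partitions cut at a part size\<close>

text \<open>An upward-closed predicate holds on a prefix of a decreasing list. With
  \<open>x > v\<close> this is the cut of a partition at the part size \<open>v\<close>.\<close>

lemma sorted_filter_append:
  assumes "sorted_wrt (\<ge>) (ps :: 'a::linorder list)" "\<And>x y. P x \<Longrightarrow> x \<le> y \<Longrightarrow> P y"
  shows "filter P ps @ filter (\<lambda>x. \<not> P x) ps = ps"
  using assms(1)
proof (induction ps)
  case (Cons a ps)
  show ?case
  proof (cases "P a")
    case False
    hence "filter P ps = []" using Cons.prems assms(2) by (auto simp: filter_empty_conv)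
    thus ?thesis using Cons False by simp
  qed (use Cons in simp)
qed simp

text \<open>The entries equal to \<open>v\<close> or \<open>Suc v\<close> form a contiguous block of
  a decreasing list, and a violation of the difference condition is a window of \<open>t + 1\<close>
  entries inside such a block.\<close>

lemma diff2_iff_count_list:
  assumes "sorted_wrt (\<ge>) (ps :: nat list)"
  shows "diff2_at_distance t ps \<longleftrightarrow> (\<forall>v. count_list ps v + count_list ps (Suc v) \<le> t)"
proof -
  have count: "count_list xs v + count_list xs (Suc v) = length (filter (\<lambda>x. x = v \<or> x = Suc v) xs)"
    for xs :: "nat list" and v by (induction xs) auto
  show ?thesis
  proof
    assume diff: "diff2_at_distance t ps"
    show "\<forall>v. count_list ps v + count_list ps (Suc v) \<le> t"
    proof (rule ccontr)
      assume "\<not> ?thesis"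
      then obtain v where v: "t < count_list ps v + count_list ps (Suc v)"
        by (auto simp: not_le)
      \<comment> \<open>The block \<open>bs\<close> starts at index \<open>length as\<close> and is
        longer than \<open>t\<close>, so its entries \<open>0\<close> and \<open>t\<close> violate
        the condition.\<close>
      define as where "as = filter (\<lambda>x. x > Suc v) ps"
      define bs where "bs = filter (\<lambda>x. x = v \<or> x = Suc v) ps"
      define cs where "cs = filter (\<lambda>x. x < v) ps"
      have ps: "ps = as @ bs @ cs"
      proof -
        let ?rs = "filter (\<lambda>x. \<not> x > Suc v) ps"
        have "sorted_wrt (\<ge>) ?rs" using assms by (rule sorted_wrt_filter)
        hence "filter (\<lambda>x. x \<ge> v) ?rs @ filter (\<lambda>x. \<not> x \<ge> v) ?rs = ?rs"
          by (rule sorted_filter_append) simp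
        moreover have "filter (\<lambda>x. x \<ge> v) ?rs = bs" "filter (\<lambda>x. \<not> x \<ge> v) ?rs = cs"
          unfolding bs_def cs_def by (auto intro!: filter_cong)
        moreover have "as @ ?rs = ps"
          unfolding as_def using assms by (rule sorted_filter_append) simp
        ultimately show ?thesis by metis
      qed
      have len: "t < length bs" using v by (simp add: count bs_def)
      hence "length as + t < length ps" by (simp add: ps)
      hence "ps ! length as \<ge> ps ! (length as + t) + 2"
        using diff unfolding diff2_at_distance_def by blast
      moreover have "ps ! length as = bs ! 0" "ps ! (length as + t) = bs ! t"
        using len by (auto simp: ps nth_append)
      moreover have "bs ! 0 \<in> set bs" "bs ! t \<in> set bs"
        using len le_less_trans[OF le0 len] by (blast intro: nth_mem)+
      ultimately show False by (auto simp: bs_def)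
    qed
  next
    assume c: "\<forall>v. count_list ps v + count_list ps (Suc v) \<le> t"
    show "diff2_at_distance t ps"
      unfolding diff2_at_distance_def
    proof (intro allI impI, rule ccontr)
      fix s assume s: "s + t < length ps" and "\<not> ps ! (s + t) + 2 \<le> ps ! s"
      hence small: "ps ! s \<le> Suc (ps ! (s + t))" by simp
      let ?v = "ps ! (s + t)"
      have mono: "ps ! b \<le> ps ! a" if "a \<le> b" "b < length ps" for a b
        using that assms by (cases "a = b") (auto simp: sorted_wrt_iff_nth_less)
      \<comment> \<open>Monotonicity squeezes the whole window between the values \<open>?v\<close>
        and \<open>Suc ?v\<close>.\<close>
      have "{s..s + t} \<subseteq> {a. a < length ps \<and> (ps ! a = ?v \<or> ps ! a = Suc ?v)}"
      proof
        fix a assume a: "a \<in> {s..s + t}"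
        hence "ps ! a \<le> ps ! s" "?v \<le> ps ! a" using s by (auto intro!: mono)
        thus "a \<in> {a. a < length ps \<and> (ps ! a = ?v \<or> ps ! a = Suc ?v)}" using a s small by auto
      qed
      hence "card {s..s + t} \<le> card {a. a < length ps \<and> (ps ! a = ?v \<or> ps ! a = Suc ?v)}"
        by (intro card_mono) auto
      also have "\<dots> = count_list ps ?v + count_list ps (Suc ?v)"
        by (simp add: count length_filter_conv_card)
      finally have "Suc t \<le> \<dots>" by simp
      thus False using c by (meson not_less_eq_eq order.trans)
    qed
  qed
qed

text \<open>Power series version of \<open>gen_fun\<close>; the combinatorics is done here and
  carried over to Laurent series at the end.\<close>

definition partition_fps :: "(nat list \<Rightarrow> bool) \<Rightarrow> 'a::field_char_0 fps" where
  "partition_fps P = Abs_fps (\<lambda>m. of_nat (card {ps. is_partition m ps \<and> P ps}))"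

lemma gen_fun_eq: "gen_fun P = fps_to_fls (partition_fps P)"
  by (simp add: gen_fun_def partition_fps_def)

lemma partition_fps_cong:
  assumes "\<And>m ps. is_partition m ps \<Longrightarrow> P ps \<longleftrightarrow> Q ps"
  shows "partition_fps P = partition_fps Q"
proof -
  have "{ps. is_partition m ps \<and> P ps} = {ps. is_partition m ps \<and> Q ps}" for m
    using assms by auto
  thus ?thesis by (simp add: partition_fps_def)
qed

lemma finite_partitions': "finite {ps. is_partition m ps \<and> P ps}"
  by (rule finite_subset[OF _ finite_partitions[of m]]) auto

lemma partition_fps_sum:
  assumes "finite A" "\<And>m ps. is_partition m ps \<Longrightarrow> P ps \<Longrightarrow> f ps \<in> A"
  shows "partition_fps P = (\<Sum>a\<in>A. partition_fps (\<lambda>ps. P ps \<and> f ps = a))"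
proof (rule fps_ext)
  fix m
  have "{ps. is_partition m ps \<and> P ps} = (\<Union>a\<in>A. {ps. is_partition m ps \<and> P ps \<and> f ps = a})"
    using assms(2) by auto
  hence "card {ps. is_partition m ps \<and> P ps} =
      (\<Sum>a\<in>A. card {ps. is_partition m ps \<and> P ps \<and> f ps = a})"
    using assms(1) by (simp only:) (subst card_UN_disjoint, auto intro: finite_partitions')
  thus "fps_nth (partition_fps P) m = fps_nth (\<Sum>a\<in>A. partition_fps (\<lambda>ps. P ps \<and> f ps = a)) m"
    by (simp add: partition_fps_def fps_sum_nth)
qed

lemma is_partition_append:
  assumes "\<And>x. x \<in> set xs \<Longrightarrow> x > v" "\<And>y. y \<in> set ys \<Longrightarrow> y \<le> v"
  shows "is_partition m (xs @ ys) \<longleftrightarrow>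
    (\<exists>a\<le>m. is_partition a xs \<and> is_partition (m - a) ys)"
proof -
  have "\<And>x y. x \<in> set xs \<Longrightarrow> y \<in> set ys \<Longrightarrow> y \<le> x" using assms by (meson le_less_trans less_imp_le)
  thus ?thesis by (auto simp: is_partition_def sorted_wrt_append)
qed

text \<open>Concatenating the parts above \<open>v\<close> with the parts up to \<open>v\<close> is
  a bijection under which sizes add, so the counts form a Cauchy product.\<close>

lemma partition_fps_split:
  assumes "\<And>xs ys. sorted_wrt (\<ge>) (xs @ ys) \<Longrightarrow> (\<And>x. x \<in> set xs \<Longrightarrow> x > v) \<Longrightarrow>
    (\<And>y. y \<in> set ys \<Longrightarrow> y \<le> v) \<Longrightarrow> P (xs @ ys) \<longleftrightarrow> Q xs \<and> R ys"
  shows "partition_fps P =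
    partition_fps (\<lambda>ps. (\<forall>x\<in>set ps. x > v) \<and> Q ps) *
    (partition_fps (\<lambda>ps. (\<forall>x\<in>set ps. x \<le> v) \<and> R ps) :: 'a::field_char_0 fps)"
proof (rule fps_ext)
  fix m
  let ?L = "\<lambda>a. {ps. is_partition a ps \<and> (\<forall>x\<in>set ps. x > v) \<and> Q ps}"
  let ?S = "\<lambda>a. {ps. is_partition a ps \<and> (\<forall>x\<in>set ps. x \<le> v) \<and> R ps}"
  \<comment> \<open>The triple records the size \<open>a\<close> of the upper piece, so that the
    cardinality of \<open>?T\<close> is the Cauchy sum.\<close>
  let ?T = "Sigma {0..m} (\<lambda>a. ?L a \<times> ?S (m - a))"
  have "bij_betw (\<lambda>(a, xs, ys). xs @ ys) ?T {ps. is_partition m ps \<and> P ps}"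
  proof (rule bij_betwI[where g = "\<lambda>ps. (sum_list (filter (\<lambda>x. x > v) ps),
        filter (\<lambda>x. x > v) ps, filter (\<lambda>x. x \<le> v) ps)"])
    show "(\<lambda>(a, xs, ys). xs @ ys) \<in> ?T \<rightarrow> {ps. is_partition m ps \<and> P ps}"
    proof (clarsimp)
      fix a xs ys
      assume *: "a \<le> m" "is_partition a xs" "is_partition (m - a) ys" "\<forall>x\<in>set xs. v < x" "Q xs"
        "\<forall>y\<in>set ys. y \<le> v" "R ys"
      have "is_partition m (xs @ ys)" using * by (subst is_partition_append[of _ v]) auto
      moreover have "P (xs @ ys)"
        using * calculation by (subst assms) (auto simp: is_partition_def)
      ultimately show "is_partition m (xs @ ys) \<and> P (xs @ ys)" by simp
    qed
    show "(\<lambda>ps. (sum_list (filter (\<lambda>x. x > v) ps), filter (\<lambda>x. x > v) ps, filter (\<lambda>x. x \<le> v) ps))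
        \<in> {ps. is_partition m ps \<and> P ps} \<rightarrow> ?T"
    proof (rule Pi_I)
      fix ps assume ps: "ps \<in> {ps. is_partition m ps \<and> P ps}"
      let ?xs = "filter (\<lambda>x. x > v) ps" and ?ys = "filter (\<lambda>x. x \<le> v) ps"
      have eq: "?xs @ ?ys = ps" 
        using ps sorted_filter_append[of ps "\<lambda>x. x > v"] by (auto simp: is_partition_def not_less)
      have "is_partition m (?xs @ ?ys)" using ps by (simp only: eq) simp
      then obtain a where a: "a \<le> m" "is_partition a ?xs" "is_partition (m - a) ?ys"
        by (subst (asm) is_partition_append[of _ v]) auto
      moreover from a have "a = sum_list ?xs" by (simp add: is_partition_def)
      moreover have "Q ?xs \<and> R ?ys"
        using ps assms[of ?xs ?ys] by (simp only: eq) (auto simp: is_partition_def)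
      ultimately show "(sum_list ?xs, ?xs, ?ys) \<in> ?T" by auto
    qed
    show "(\<lambda>ps. (sum_list (filter (\<lambda>x. x > v) ps), filter (\<lambda>x. x > v) ps, filter (\<lambda>x. x \<le> v) ps))
        (case z of (a, xs, ys) \<Rightarrow> xs @ ys) = z" if "z \<in> ?T" for z
    proof -
      obtain a xs ys where z: "z = (a, xs, ys)" by (cases z)
      have "filter (\<lambda>x. x > v) xs = xs" "filter (\<lambda>x. x > v) ys = []"
        "filter (\<lambda>x. x \<le> v) xs = []" "filter (\<lambda>x. x \<le> v) ys = ys"
        using that unfolding z by (auto simp: filter_empty_conv filter_id_conv not_le not_less)
      thus ?thesis using that unfolding z by (auto simp: is_partition_def)
    qed
    show "(case (sum_list (filter (\<lambda>x. x > v) ps), filter (\<lambda>x. x > v) ps, filter (\<lambda>x. x \<le> v) ps)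
        of (a, xs, ys) \<Rightarrow> xs @ ys) = ps" if "ps \<in> {ps. is_partition m ps \<and> P ps}" for ps
      using that sorted_filter_append[of ps "\<lambda>x. x > v"]
      by (auto simp: is_partition_def not_less)
  qed
  hence "card {ps. is_partition m ps \<and> P ps} = card ?T" by (rule bij_betw_same_card[symmetric])
  also have "\<dots> = (\<Sum>a=0..m. card (?L a) * card (?S (m - a)))"
    by (subst card_SigmaI) (auto simp: card_cartesian_product finite_partitions')
  finally show "fps_nth (partition_fps P) m = fps_nth (partition_fps (\<lambda>ps. (\<forall>x\<in>set ps. x > v) \<and> Q ps) *
    (partition_fps (\<lambda>ps. (\<forall>x\<in>set ps. x \<le> v) \<and> R ps) :: 'a fps)) m"
    by (simp add: partition_fps_def fps_mult_nth)
qed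

lemma partition_fps_single:
  assumes "v > 0"
  shows "partition_fps (\<lambda>ps. (\<forall>x\<in>set ps. x = v) \<and> count_list ps v = n) =
    (fps_X ^ (v * n) :: 'a::field_char_0 fps)"
proof (rule fps_ext)
  fix m
  have rep: "ps = replicate n v" if "\<forall>x\<in>set ps. x = v" "count_list ps v = n" for ps
  proof -
    have "replicate (length ps) v = ps" using that(1) by (intro replicate_length_same) auto
    moreover have "count_list (replicate (length ps) v) v = length ps"
      by (induction ps) auto
    ultimately show ?thesis using that(2) by simp
  qed
  have "count_list (replicate n v) v = n" by (induction n) auto
  hence "is_partition (v * n) (replicate n v) \<and> (\<forall>x\<in>set (replicate n v). x = v)
      \<and> count_list (replicate n v) v = n"
    using assms by (auto simp: is_partition_def sum_list_replicate sorted_wrt_iff_nth_less)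
  moreover have "m = v * n" if "is_partition m (replicate n v)"
    using that by (simp add: is_partition_def sum_list_replicate mult.commute)
  ultimately have "is_partition m ps \<and> (\<forall>x\<in>set ps. x = v) \<and> count_list ps v = n \<longleftrightarrow>
      m = v * n \<and> ps = replicate n v" for ps
    using rep[of ps] by metis
  hence "{ps. is_partition m ps \<and> (\<forall>x\<in>set ps. x = v) \<and> count_list ps v = n} =
      (if m = v * n then {replicate n v} else {})"
    by auto
  thus "fps_nth (partition_fps (\<lambda>ps. (\<forall>x\<in>set ps. x = v) \<and> count_list ps v = n)) m =
      fps_nth (fps_X ^ (v * n) :: 'a fps) m"
    by (simp add: partition_fps_def)
qed

subsection \<open>Recurrences for the partition generating functions\<close>

lemma count_list_0: "\<forall>x\<in>set xs. x \<noteq> v \<Longrightarrow> count_list xs v = 0"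
  by (auto simp: count_list_0_iff)

text \<open>The only pair of adjacent values that straddles the cut is \<open>v\<close>,
  \<open>Suc v\<close>; every other pair is governed by one piece alone.\<close>

lemma diff2_append:
  assumes sorted: "sorted_wrt (\<ge>) (xs @ ys)"
    and xs: "\<And>x. x \<in> set xs \<Longrightarrow> x > v" and ys: "\<And>y. y \<in> set ys \<Longrightarrow> y \<le> v"
  shows "diff2_at_distance t (xs @ ys) \<longleftrightarrow>
    diff2_at_distance t xs \<and> diff2_at_distance t ys \<and> count_list xs (Suc v) + count_list ys v \<le> t"
proof -
  have "sorted_wrt (\<ge>) xs" "sorted_wrt (\<ge>) ys" using sorted by (auto simp: sorted_wrt_append)
  note iff = this[THEN diff2_iff_count_list] sorted[THEN diff2_iff_count_list]
  have xs0: "count_list xs w = 0" if "w \<le> v" for w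
    using xs that by (intro count_list_0) force
  have ys0: "count_list ys w = 0" if "w > v" for w
    using ys that by (intro count_list_0) force
  have "count_list (xs @ ys) w + count_list (xs @ ys) (Suc w) \<le> t \<longleftrightarrow>
    count_list xs w + count_list xs (Suc w) \<le> t \<and> count_list ys w + count_list ys (Suc w) \<le> t \<and>
    (w = v \<longrightarrow> count_list xs (Suc v) + count_list ys v \<le> t)" for w
    using xs0[of w] xs0[of "Suc w"] ys0[of w] ys0[of "Suc w"]
    by (cases w v rule: linorder_cases) (auto simp: count_list_append)
  thus ?thesis unfolding iff by blast
qed

lemma diff2_const:
  assumes "\<forall>x\<in>set xs. x = v" "count_list xs v \<le> t"
  shows "diff2_at_distance t xs"
proof -
  have "sorted_wrt (\<ge>) xs" using assms(1) by (induction xs) auto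
  moreover have "count_list xs w + count_list xs (Suc w) \<le> t" for w
  proof -
    have "count_list xs u = 0" if "u \<noteq> v" for u using assms(1) that by (intro count_list_0) auto
    thus ?thesis using assms(2) by (cases "w = v"; cases "Suc w = v") auto
  qed
  ultimately show ?thesis by (simp add: diff2_iff_count_list)
qed

lemma count_list_le_of_diff2:
  assumes "is_partition m ps" "diff2_at_distance t ps"
  shows "count_list ps v \<le> t"
proof -
  have "count_list ps v + count_list ps (Suc v) \<le> t"
    using assms diff2_iff_count_list[of ps t] by (simp add: is_partition_def)
  thus ?thesis by simp
qed

text \<open>This is the series \<open>C j i\<close> of the outline, for a fixed
  \<open>k\<close>.\<close>

definition gordon_tail :: "nat \<Rightarrow> nat \<Rightarrow> nat \<Rightarrow> 'a::field_char_0 fps" where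
  "gordon_tail k j i = partition_fps (\<lambda>ps. (\<forall>x\<in>set ps. x > j) \<and> diff2_at_distance (k - 1) ps
     \<and> count_list ps (Suc j) < i)"

text \<open>The part of a partition complementary to \<open>gordon_tail\<close>; it becomes the
  entry in row \<open>i\<close> and column \<open>l\<close>, counted from 1, of the product of the
  first \<open>j\<close> matrices.\<close>

definition gordon_head :: "nat \<Rightarrow> nat \<Rightarrow> nat \<Rightarrow> nat \<Rightarrow> 'a::field_char_0 fps" where
  "gordon_head k i j l = partition_fps (\<lambda>ps. (\<forall>x\<in>set ps. x \<le> j) \<and> diff2_at_distance (k - 1) ps
     \<and> count_list ps 1 \<le> k - i \<and> count_list ps j = l - 1)"

lemma partition_fps_disj:
  "partition_fps P = partition_fps (\<lambda>ps. P ps \<and> Q ps) + partition_fps (\<lambda>ps. P ps \<and> \<not> Q ps)"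
  using partition_fps_sum[of "{True, False}" P Q] by simp

lemma gordon_tail_0: "gordon_tail k j 0 = 0"
  by (simp add: gordon_tail_def partition_fps_def fps_eq_iff)

text \<open>A nonempty partition into parts above \<open>j\<close> has size at least
  \<open>Suc j\<close>. This is the initial condition for the recurrence.\<close>

lemma gordon_tail_nth:
  assumes "i > 0" "m \<le> j"
  shows "fps_nth (gordon_tail k j i) m = (if m = 0 then 1 else 0)"
proof -
  have "ps = []" if "is_partition m ps" "\<forall>x\<in>set ps. x > j" for ps
    using that assms(2) member_le_sum_list[of _ ps] by (cases ps) (auto simp: is_partition_def)
  hence "is_partition m ps \<and> (\<forall>x\<in>set ps. x > j) \<and> diff2_at_distance (k - 1) ps
     \<and> count_list ps (Suc j) < i \<longleftrightarrow> m = 0 \<and> ps = []" for ps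
    using assms(1) by (cases "ps = []") (auto simp: is_partition_def diff2_at_distance_def)
  hence "{ps. is_partition m ps \<and> (\<forall>x\<in>set ps. x > j) \<and> diff2_at_distance (k - 1) ps
     \<and> count_list ps (Suc j) < i} = (if m = 0 then {[]} else {})"
    by auto
  thus ?thesis by (simp add: gordon_tail_def partition_fps_def)
qed

text \<open>The second summand counts the partitions with exactly \<open>i\<close> parts
  \<open>Suc j\<close>. Removing them gives the monomial, and at most \<open>k - 1 - i\<close> parts
  \<open>Suc (Suc j)\<close> are then allowed.\<close>

lemma gordon_tail_Suc:
  assumes "i < k"
  shows "gordon_tail k j (Suc i) =
    gordon_tail k j i + fps_X ^ (Suc j * i) * (gordon_tail k (Suc j) (k - i) :: 'a::field_char_0 fps)"
proof -
  let ?P = "\<lambda>ps. (\<forall>x\<in>set ps. x > j) \<and> diff2_at_distance (k - 1) ps \<and> count_list ps (Suc j) = i"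
  let ?Q = "\<lambda>ps. diff2_at_distance (k - 1) ps \<and> count_list ps (Suc (Suc j)) < k - i"
  let ?R = "\<lambda>ps. (\<forall>x\<in>set ps. x = Suc j) \<and> count_list ps (Suc j) = i"
  have "gordon_tail k j (Suc i) = gordon_tail k j i + (partition_fps ?P :: 'a fps)"
    unfolding gordon_tail_def
    by (subst partition_fps_disj[where Q = "\<lambda>ps. count_list ps (Suc j) < i"])
      (intro arg_cong2[where f = "(+)"] partition_fps_cong, auto)
  also have "partition_fps ?P =
      partition_fps (\<lambda>ps. (\<forall>x\<in>set ps. x > Suc j) \<and> ?Q ps) *
      (partition_fps (\<lambda>ps. (\<forall>x\<in>set ps. x \<le> Suc j) \<and> ?R ps) :: 'a fps)"
  proof (rule partition_fps_split)
    fix xs ys :: "nat list"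
    assume sorted: "sorted_wrt (\<ge>) (xs @ ys)"
      and xs: "\<And>x. x \<in> set xs \<Longrightarrow> x > Suc j" and ys: "\<And>y. y \<in> set ys \<Longrightarrow> y \<le> Suc j"
    have "count_list xs (Suc j) = 0" using xs by (intro count_list_0) force
    moreover have "(\<forall>x\<in>set (xs @ ys). x > j) \<longleftrightarrow> (\<forall>x\<in>set ys. x = Suc j)"
    proof -
      have "\<forall>x\<in>set xs. x > j" using xs by (meson Suc_lessD)
      moreover have "\<forall>x\<in>set ys. x > j \<longleftrightarrow> x = Suc j" using ys by (metis le_antisym less_eq_Suc_le lessI)
      ultimately show ?thesis by auto
    qed
    moreover have "diff2_at_distance (k - 1) ys" if "?R ys"
      using that assms by (intro diff2_const[of _ "Suc j"]) auto
    ultimately show "?P (xs @ ys) \<longleftrightarrow> ?Q xs \<and> ?R ys"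
      using assms by (auto simp: diff2_append[OF sorted xs ys] count_list_append)
  qed
  also have "partition_fps (\<lambda>ps. (\<forall>x\<in>set ps. x \<le> Suc j) \<and> ?R ps) = partition_fps ?R"
    by (intro partition_fps_cong) auto
  also have "\<dots> = (fps_X ^ (Suc j * i) :: 'a fps)" by (rule partition_fps_single) simp
  finally show ?thesis by (simp add: gordon_tail_def mult.commute)
qed

text \<open>Only \<open>l - 1\<close> ones are present, and the bound \<open>k - i\<close> admits
  them exactly when \<open>i + l \<le> k + 1\<close>. These are the entries of the first
  matrix.\<close>

lemma gordon_head_1:
  assumes "1 \<le> l" "1 \<le> i" "i \<le> k"
  shows "gordon_head k i 1 l = (if i + l \<le> k + 1 then fps_X ^ (l - 1) else 0 :: 'a::field_char_0 fps)"
proof (cases "i + l \<le> k + 1")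
  case True
  have "gordon_head k i 1 l = partition_fps (\<lambda>ps. (\<forall>x\<in>set ps. x = 1) \<and> count_list ps 1 = l - 1)"
    unfolding gordon_head_def
  proof (rule partition_fps_cong)
    fix m ps assume "is_partition m ps"
    hence "x \<le> 1 \<longleftrightarrow> x = 1" if "x \<in> set ps" for x
      using that by (cases x) (auto simp: is_partition_def)
    moreover have "diff2_at_distance (k - 1) ps" if "\<forall>x\<in>set ps. x = 1" "count_list ps 1 = l - 1"
      using that True assms by (intro diff2_const[of _ 1]) auto
    ultimately show "(\<forall>x\<in>set ps. x \<le> 1) \<and> diff2_at_distance (k - 1) ps \<and> count_list ps 1 \<le> k - i
        \<and> count_list ps 1 = l - 1 \<longleftrightarrow> (\<forall>x\<in>set ps. x = 1) \<and> count_list ps 1 = l - 1"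
      using True assms by auto
  qed
  also have "\<dots> = (fps_X ^ (1 * (l - 1)) :: 'a fps)" by (rule partition_fps_single) simp
  finally show ?thesis using True by simp
next
  case False
  hence "k - i < l - 1" using assms by auto
  hence "gordon_head k i 1 l = partition_fps (\<lambda>_. False)"
    unfolding gordon_head_def by (intro partition_fps_cong) auto
  thus ?thesis using False by (simp add: partition_fps_def fps_eq_iff)
qed

text \<open>Sorting by the multiplicity \<open>l' - 1\<close> of \<open>j\<close> turns the step to
  \<open>Suc j\<close> into right multiplication by \<open>gordon_A k (Suc j)\<close>: the parts
  \<open>Suc j\<close> give the monomial and are compatible exactly when
  \<open>(l' - 1) + (l - 1) \<le> k - 1\<close>.\<close>

lemma gordon_head_Suc:
  assumes "1 \<le> l" "1 \<le> j" "1 \<le> k"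
  shows "gordon_head k i (Suc j) l = (\<Sum>l' = 1..k. gordon_head k i j l' *
    (if l' + l \<le> k + 1 then fps_X ^ ((l - 1) * Suc j) else 0 :: 'a::field_char_0 fps))"
proof -
  let ?P = "\<lambda>ps. (\<forall>x\<in>set ps. x \<le> Suc j) \<and> diff2_at_distance (k - 1) ps
     \<and> count_list ps 1 \<le> k - i \<and> count_list ps (Suc j) = l - 1"
  have "gordon_head k i (Suc j) l =
      (\<Sum>l' = 1..k. partition_fps (\<lambda>ps. ?P ps \<and> Suc (count_list ps j) = l') :: 'a fps)"
    unfolding gordon_head_def
    using assms(3) by (intro partition_fps_sum) (auto dest!: count_list_le_of_diff2[where v = j])
  also have "\<dots> = (\<Sum>l' = 1..k. gordon_head k i j l' *
    (if l' + l \<le> k + 1 then fps_X ^ ((l - 1) * Suc j) else 0 :: 'a::field_char_0 fps))"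
  proof (rule sum.cong)
    fix l' assume l': "l' \<in> {1..k}"
    show "partition_fps (\<lambda>ps. ?P ps \<and> Suc (count_list ps j) = l') = gordon_head k i j l' *
      (if l' + l \<le> k + 1 then fps_X ^ ((l - 1) * Suc j) else 0 :: 'a fps)"
    proof (cases "l' + l \<le> k + 1")
      case True
      let ?Q = "\<lambda>ps. (\<forall>x\<in>set ps. x = Suc j) \<and> count_list ps (Suc j) = l - 1"
      let ?R = "\<lambda>ps. diff2_at_distance (k - 1) ps \<and> count_list ps 1 \<le> k - i \<and> count_list ps j = l' - 1"
      have "partition_fps (\<lambda>ps. ?P ps \<and> Suc (count_list ps j) = l') =
        partition_fps (\<lambda>ps. (\<forall>x\<in>set ps. x > j) \<and> ?Q ps) *
        (partition_fps (\<lambda>ps. (\<forall>x\<in>set ps. x \<le> j) \<and> ?R ps) :: 'a fps)"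
      proof (rule partition_fps_split)
        fix xs ys :: "nat list"
        assume sorted: "sorted_wrt (\<ge>) (xs @ ys)"
          and xs: "\<And>x. x \<in> set xs \<Longrightarrow> x > j" and ys: "\<And>y. y \<in> set ys \<Longrightarrow> y \<le> j"
        have "count_list xs j = 0" "count_list xs 1 = 0"
          using xs assms(2) by (intro count_list_0; force)+
        moreover have "count_list ys (Suc j) = 0" using ys by (intro count_list_0) force
        moreover have "(\<forall>x\<in>set (xs @ ys). x \<le> Suc j) \<longleftrightarrow> (\<forall>x\<in>set xs. x = Suc j)"
        proof -
          have "\<forall>y\<in>set ys. y \<le> Suc j" using ys by (meson le_SucI)
          moreover have "\<forall>x\<in>set xs. x \<le> Suc j \<longleftrightarrow> x = Suc j" using xs by (metis le_antisym less_eq_Suc_le order_refl)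
          ultimately show ?thesis by auto
        qed
        moreover have "diff2_at_distance (k - 1) xs" if "?Q xs"
          using that True l' by (intro diff2_const[of _ "Suc j"]) auto
        ultimately show "?P (xs @ ys) \<and> Suc (count_list (xs @ ys) j) = l' \<longleftrightarrow> ?Q xs \<and> ?R ys"
          using True l' assms by (auto simp: diff2_append[OF sorted xs ys] count_list_append)
      qed
      also have "partition_fps (\<lambda>ps. (\<forall>x\<in>set ps. x > j) \<and> ?Q ps) = partition_fps ?Q"
        by (intro partition_fps_cong) auto
      also have "\<dots> = (fps_X ^ (Suc j * (l - 1)) :: 'a fps)" by (rule partition_fps_single) simp
      finally show ?thesis using True by (simp add: gordon_head_def mult.commute)
    next
      case False
      have "\<not> (?P ps \<and> Suc (count_list ps j) = l')" if "is_partition m ps" for m ps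
      proof
        assume P: "?P ps \<and> Suc (count_list ps j) = l'"
        hence "count_list ps j + count_list ps (Suc j) \<le> k - 1"
          using that diff2_iff_count_list[of ps "k - 1"] unfolding is_partition_def by blast
        thus False using P False assms by auto
      qed
      hence "partition_fps (\<lambda>ps. ?P ps \<and> Suc (count_list ps j) = l') = partition_fps (\<lambda>ps. False)"
        by (intro partition_fps_cong) blast
      thus ?thesis using False by (simp add: partition_fps_def fps_eq_iff)
    qed
  qed simp
  finally show ?thesis .
qed

text \<open>Once \<open>j\<close> occurs \<open>l - 1\<close> times, the only link between the two
  pieces is that \<open>Suc j\<close> occurs fewer than \<open>k + 1 - l\<close> times.\<close>

lemma partition_fps_head_tail:
  assumes "1 \<le> l" "l \<le> k" "1 \<le> j"
  shows "partition_fps (\<lambda>ps. diff2_at_distance (k - 1) ps \<and> count_list ps 1 \<le> k - i \<and> count_list ps j = l - 1)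
    = gordon_head k i j l * (gordon_tail k j (k + 1 - l) :: 'a::field_char_0 fps)"
proof -
  let ?Q = "\<lambda>ps. diff2_at_distance (k - 1) ps \<and> count_list ps (Suc j) < k + 1 - l"
  let ?R = "\<lambda>ps. diff2_at_distance (k - 1) ps \<and> count_list ps 1 \<le> k - i \<and> count_list ps j = l - 1"
  have "partition_fps ?R = partition_fps (\<lambda>ps. (\<forall>x\<in>set ps. x > j) \<and> ?Q ps) *
        (partition_fps (\<lambda>ps. (\<forall>x\<in>set ps. x \<le> j) \<and> ?R ps) :: 'a fps)"
  proof (rule partition_fps_split)
    fix xs ys :: "nat list"
    assume sorted: "sorted_wrt (\<ge>) (xs @ ys)"
      and xs: "\<And>x. x \<in> set xs \<Longrightarrow> x > j" and ys: "\<And>y. y \<in> set ys \<Longrightarrow> y \<le> j"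
    have "count_list xs j = 0" "count_list xs 1 = 0"
      using xs assms(3) by (intro count_list_0; force)+
    thus "?R (xs @ ys) \<longleftrightarrow> ?Q xs \<and> ?R ys"
      using assms by (auto simp: diff2_append[OF sorted xs ys] count_list_append)
  qed
  thus ?thesis by (simp add: gordon_head_def gordon_tail_def mult.commute)
qed

text \<open>The difference condition forbids more than \<open>k - 1\<close> copies of any part, so
  \<open>l - 1\<close> runs through all possible multiplicities of \<open>j\<close>.\<close>

lemma partition_fps_sum_count:
  assumes "1 \<le> k"
  shows "partition_fps (\<lambda>ps. diff2_at_distance (k - 1) ps \<and> count_list ps 1 \<le> k - i) =
    (\<Sum>l = 1..k. partition_fps (\<lambda>ps. diff2_at_distance (k - 1) ps \<and> count_list ps 1 \<le> k - i
       \<and> count_list ps j = l - 1) :: 'a::field_char_0 fps)"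
proof -
  let ?P = "\<lambda>ps. diff2_at_distance (k - 1) ps \<and> count_list ps 1 \<le> k - i"
  have "partition_fps ?P = (\<Sum>l = 1..k. partition_fps (\<lambda>ps. ?P ps \<and> Suc (count_list ps j) = l) :: 'a fps)"
    using assms by (intro partition_fps_sum) (auto dest!: count_list_le_of_diff2[where v = j])
  also have "\<dots> = (\<Sum>l = 1..k. partition_fps (\<lambda>ps. ?P ps \<and> count_list ps j = l - 1))"
    by (intro sum.cong refl partition_fps_cong) auto
  finally show ?thesis by (simp add: conj_assoc)
qed

subsection \<open>Congruence of power series modulo a power of the indeterminate\<close>

definition fps_cong :: "nat \<Rightarrow> 'a::comm_ring_1 fps \<Rightarrow> 'a fps \<Rightarrow> bool" where
  "fps_cong N f g \<longleftrightarrow> fps_X ^ N dvd f - g"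

lemma fps_X_power_dvd_iff:
  "fps_X ^ N dvd (f :: 'a::comm_ring_1 fps) \<longleftrightarrow> (\<forall>m<N. fps_nth f m = 0)"
proof
  assume "\<forall>m<N. fps_nth f m = 0"
  hence "f = fps_X ^ N * fps_shift N f"
    by (intro fps_ext) (simp add: fps_X_power_mult_nth)
  thus "fps_X ^ N dvd f" by (rule dvdI)
qed (auto simp: fps_X_power_mult_nth elim!: dvdE)

lemma fps_cong_iff: "fps_cong N f g \<longleftrightarrow> (\<forall>m<N. fps_nth f m = fps_nth g m)"
  by (simp add: fps_cong_def fps_X_power_dvd_iff)

lemma fps_cong_refl [simp]: "fps_cong N f f"
  by (simp add: fps_cong_def)

lemma fps_cong_sym: "fps_cong N f g \<Longrightarrow> fps_cong N g f"
  by (simp add: fps_cong_iff)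

lemma fps_cong_trans [trans]: "fps_cong N f g \<Longrightarrow> fps_cong N g h \<Longrightarrow> fps_cong N f h"
  by (simp add: fps_cong_iff)

text \<open>Without these two rules \<open>also\<close> falls back on general substitution, whose higher-order unification explodes.\<close>

lemma fps_cong_eq_trans [trans]: "fps_cong N f g \<Longrightarrow> g = h \<Longrightarrow> fps_cong N f h"
  and eq_fps_cong_trans [trans]: "f = g \<Longrightarrow> fps_cong N g h \<Longrightarrow> fps_cong N f h"
  by simp_all

lemma fps_cong_mono: "fps_cong N f g \<Longrightarrow> M \<le> N \<Longrightarrow> fps_cong M f g"
  by (simp add: fps_cong_iff)

lemma fps_eqI_cong: "(\<And>N. fps_cong N f g) \<Longrightarrow> f = g"
  by (rule fps_ext) (use fps_cong_iff in blast)

lemma fps_cong_add: "fps_cong N f g \<Longrightarrow> fps_cong N f' g' \<Longrightarrow> fps_cong N (f + f') (g + g')"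
  by (simp add: fps_cong_iff)

lemma fps_cong_diff: "fps_cong N f g \<Longrightarrow> fps_cong N f' g' \<Longrightarrow> fps_cong N (f - f') (g - g')"
  by (simp add: fps_cong_iff)

lemma fps_cong_mult:
  assumes "fps_cong N f g" "fps_cong N f' g'"
  shows "fps_cong N (f * f') (g * g')"
proof -
  have "f * f' - g * g' = (f - g) * f' + g * (f' - g')" by (simp add: algebra_simps)
  thus ?thesis using assms unfolding fps_cong_def by (simp add: dvd_mult dvd_mult2)
qed

lemma fps_cong_sum: "(\<And>a. a \<in> A \<Longrightarrow> fps_cong N (f a) (g a)) \<Longrightarrow> fps_cong N (sum f A) (sum g A)"
  by (simp add: fps_cong_iff fps_sum_nth)

lemma fps_cong_mult_cancel:
  fixes c :: "'a::field fps"
  assumes "fps_cong N (c * f) (c * g)" "fps_nth c 0 \<noteq> 0"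
  shows "fps_cong N f g"
proof -
  have "fps_cong N (inverse c * (c * f)) (inverse c * (c * g))"
    using assms(1) by (rule fps_cong_mult[OF fps_cong_refl])
  thus ?thesis by (simp only: mult.assoc[symmetric] inverse_mult_eq_1[OF assms(2)] mult_1)
qed

lemma fps_cong_prod_lessThan:
  fixes f :: "nat \<Rightarrow> 'a::comm_ring_1 fps"
  assumes "\<And>n. n \<ge> j \<Longrightarrow> fps_cong N (f n) 1" "j \<le> T"
  shows "fps_cong N (\<Prod>n<T. f n) (\<Prod>n<j. f n)"
  using assms(2)
proof (induction T rule: dec_induct)
  case (step n)
  have "fps_cong N ((\<Prod>n<n. f n) * f n) ((\<Prod>n<j. f n) * 1)"
    using step assms(1) by (intro fps_cong_mult) auto
  thus ?case by simp
qed simp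

lemma fps_cong_sum_lessThan:
  fixes f :: "nat \<Rightarrow> 'a::comm_ring_1 fps"
  assumes "\<And>n. n \<ge> j \<Longrightarrow> fps_cong N (f n) 0" "j \<le> T"
  shows "fps_cong N (\<Sum>n<T. f n) (\<Sum>n<j. f n)"
  using assms(2)
proof (induction T rule: dec_induct)
  case (step n)
  have "fps_cong N ((\<Sum>n<n. f n) + f n) ((\<Sum>n<j. f n) + 0)"
    using step assms(1) by (intro fps_cong_add) auto
  thus ?case by simp
qed simp

lemma fps_cong_X_power_0: "N \<le> n \<Longrightarrow> fps_cong N (fps_X ^ n * f) 0"
  by (simp add: fps_cong_def le_imp_power_dvd)

lemma fps_cong_one_minus_X_power: "N \<le> n \<Longrightarrow> fps_cong N (1 - fps_X ^ n) 1"
  using fps_cong_X_power_0[of N n "- 1"] by (simp add: fps_cong_def)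

text \<open>Only meaningful if the coefficient of \<open>X ^ m\<close> in \<open>f T\<close> is constant for \<open>T > m\<close>.\<close>

definition fps_limit :: "(nat \<Rightarrow> 'a::comm_ring_1 fps) \<Rightarrow> 'a fps" where
  "fps_limit f = Abs_fps (\<lambda>m. fps_nth (f (Suc m)) m)"

lemma fps_cong_limit:
  assumes "\<And>N T. N \<le> T \<Longrightarrow> fps_cong N (f T) (f N)" "N \<le> T"
  shows "fps_cong N (fps_limit f) (f T)"
  unfolding fps_cong_iff fps_limit_def
proof (intro allI impI)
  fix m assume "m < N"
  hence "fps_cong (Suc m) (f T) (f (Suc m))" using assms(2) by (intro assms(1)) simp
  thus "fps_nth (Abs_fps (\<lambda>m. fps_nth (f (Suc m)) m)) m = fps_nth (f T) m"
    by (simp add: fps_cong_iff)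
qed

text \<open>A finite q-Pochhammer symbol. The base stays general because powers of
  \<open>fps_X\<close> occur as well.\<close>

definition euler_prod :: "'a::comm_ring_1 \<Rightarrow> nat \<Rightarrow> 'a" where
  "euler_prod x j = (\<Prod>n<j. 1 - x ^ Suc n)"

lemma euler_prod_0 [simp]: "euler_prod x 0 = 1"
  and euler_prod_Suc: "euler_prod x (Suc j) = euler_prod x j * (1 - x ^ Suc j)"
  by (simp_all add: euler_prod_def)

lemma euler_prod_nth_0: "r > 0 \<Longrightarrow> fps_nth (euler_prod (fps_X ^ r :: 'a::field fps) j) 0 = 1"
  by (induction j) (auto simp: euler_prod_Suc fps_mult_nth_0 simp flip: power_mult)

lemma fps_cong_euler_prod:
  assumes "r > 0" "j \<le> T"
  shows "fps_cong (Suc j) (euler_prod (fps_X ^ r) T) (euler_prod (fps_X ^ r) j)"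
  unfolding euler_prod_def
proof (rule fps_cong_prod_lessThan)
  fix n assume n: "j \<le> n"
  have "Suc n \<le> r * Suc n" using assms(1) by (cases r) auto
  hence "Suc j \<le> r * Suc n" using n by linarith
  thus "fps_cong (Suc j) (1 - (fps_X ^ r) ^ Suc n) 1"
    unfolding power_mult[symmetric] by (rule fps_cong_one_minus_X_power)
qed (use assms in auto)

definition euler_fps :: "'a::comm_ring_1 fps" where
  "euler_fps = fps_limit (euler_prod fps_X)"

lemma fps_cong_euler_fps: "fps_cong (Suc j) euler_fps (euler_prod fps_X j)"
proof -
  have *: "fps_cong (Suc j) (euler_prod fps_X T) (euler_prod fps_X j)" if "j \<le> T" for j T
    using fps_cong_euler_prod[of 1 j T] that by simp
  \<comment> \<open>The limit estimate needs length \<open>Suc j\<close>; the last factor is 1 at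
    this precision and is dropped next.\<close>
  have "fps_cong (Suc j) euler_fps (euler_prod fps_X (Suc j))"
    unfolding euler_fps_def by (intro fps_cong_limit) (auto intro: fps_cong_mono[OF *])
  also have "fps_cong (Suc j) (euler_prod fps_X (Suc j)) (euler_prod fps_X j)" by (rule *) simp
  finally show ?thesis .
qed

lemma euler_fps_nonzero: "euler_fps \<noteq> (0 :: 'a::field fps)"
  using fps_cong_euler_fps[of 0, where 'a = 'a] by (auto simp: fps_cong_iff)

subsection \<open>The alternating series\<close>

text \<open>The summand of Andrews' series at the argument \<open>x ^ j\<close>, multiplied by
  Euler's infinite product. That product turns the infinite denominator into the finite product over
  \<open>t < j\<close>.\<close>

definition gordon_term :: "'a::comm_ring_1 \<Rightarrow> nat \<Rightarrow> nat \<Rightarrow> nat \<Rightarrow> nat \<Rightarrow> 'a" where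
  "gordon_term x k j i n = (-1) ^ n * x ^ (k * j * n + k * n\<^sup>2 + (Suc n choose 2) + (k - i) * n)
     * (1 - x ^ ((2 * n + 1 + j) * i)) * (\<Prod>t<j. 1 - x ^ (n + t + 1))"

definition gordon_numer :: "nat \<Rightarrow> nat \<Rightarrow> nat \<Rightarrow> 'a::comm_ring_1 fps" where
  "gordon_numer k j i = fps_limit (\<lambda>T. \<Sum>n<T. gordon_term fps_X k j i n)"

lemma choose_2_Suc: "Suc n choose 2 = (n choose 2) + n"
  by (simp add: numeral_2_eq_2)

lemma le_choose_2: "n \<le> Suc n choose 2"
  by (simp add: choose_2_Suc)

lemma fps_cong_gordon_term:
  assumes "N \<le> k * j * n + k * n\<^sup>2 + (Suc n choose 2) + (k - i) * n"
  shows "fps_cong N (gordon_term fps_X k j i n) 0"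
  using fps_cong_X_power_0[OF assms, of "(-1) ^ n * (1 - fps_X ^ ((2 * n + 1 + j) * i)) *
    (\<Prod>t<j. 1 - fps_X ^ (n + t + 1))"]
  unfolding gordon_term_def by (simp only: mult_ac)

lemma fps_cong_gordon_numer: "N \<le> T \<Longrightarrow> fps_cong N (gordon_numer k j i) (\<Sum>n<T. gordon_term fps_X k j i n)"
  unfolding gordon_numer_def
proof (rule fps_cong_limit)
  fix N T :: nat assume "N \<le> T"
  thus "fps_cong N (\<Sum>n<T. gordon_term fps_X k j i n) (\<Sum>n<N. gordon_term fps_X k j i n)"
    using le_choose_2 by (intro fps_cong_sum_lessThan fps_cong_gordon_term) (meson le_add2 le_trans trans_le_add1)+
qed

text \<open>The recurrence holds termwise up to the telescoping error \<open>u n - u (n + 1)\<close>.\<close>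

lemma gordon_term_Suc:
  fixes x :: "'a::comm_ring_1" and k j i n :: nat
  assumes "i < k"
  defines "u \<equiv> \<lambda>n. (-1) ^ n * x ^ (k * j * n + k * n\<^sup>2 + (Suc n choose 2) + (k - Suc i) * n)
     * (1 - x ^ n) * (\<Prod>t<j. 1 - x ^ (n + t + 1))"
  shows "gordon_term x k j (Suc i) n =
    gordon_term x k j i n + x ^ (Suc j * i) * gordon_term x k (Suc j) (k - i) n + u n - u (Suc n)"
proof -
  \<comment> \<open>Writing \<open>k = i + d + 1\<close> removes truncated subtraction from the
    exponents.\<close>
  obtain d where k: "k = Suc (i + d)" using assms(1) less_imp_Suc_add by blast
  define P where "P = (\<Prod>t<j. 1 - x ^ (n + t + 1))"
  define m where "m = x ^ (k * j * n + k * n\<^sup>2 + (Suc n choose 2) + d * n)"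
  define s :: 'a where "s = (-1) ^ n"
  have d: "k - Suc i = d" "k - i = Suc d" "k - Suc d = i" using k by auto
  have P1: "(\<Prod>t<Suc j. 1 - x ^ (n + t + 1)) = P * (1 - x ^ (n + j + 1))"
    by (simp add: P_def)
  \<comment> \<open>Splitting off the first factor instead of the last exposes the product that
    belongs to \<open>u (Suc n)\<close>.\<close>
  have "(\<Prod>t<Suc j. 1 - x ^ (n + t + 1)) = (1 - x ^ Suc n) * (\<Prod>t<j. 1 - x ^ (Suc n + t + 1))"
    by (subst prod.lessThan_Suc_shift) simp
  hence P2: "(1 - x ^ Suc n) * (\<Prod>t<j. 1 - x ^ (Suc n + t + 1)) = P * (1 - x ^ (n + j + 1))"
    using P1 by simp
  have t1: "gordon_term x k j (Suc i) n = s * m * (1 - x ^ ((2 * n + 1 + j) * Suc i)) * P"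
    unfolding gordon_term_def d m_def s_def P_def ..
  have t0: "gordon_term x k j i n = s * m * x ^ n * (1 - x ^ ((2 * n + 1 + j) * i)) * P"
    unfolding gordon_term_def d m_def s_def P_def by (simp add: power_add mult_ac)
  have u0: "u n = s * m * (1 - x ^ n) * P"
    unfolding u_def d m_def s_def P_def ..
  have "x ^ (Suc j * i) * x ^ (k * Suc j * n + k * n\<^sup>2 + (Suc n choose 2) + i * n)
      = m * x ^ (n + (2 * n + 1 + j) * i)"
    unfolding m_def power_add[symmetric] by (rule arg_cong[where f = "power x"]) (simp add: k algebra_simps)
  moreover have "a * (s * b * c * p) = s * (a * b) * c * p" for a b c p
    by (simp only: mult_ac)
  ultimately have t2: "x ^ (Suc j * i) * gordon_term x k (Suc j) (k - i) n =
      s * (m * x ^ (n + (2 * n + 1 + j) * i)) * (1 - x ^ ((2 * n + 1 + Suc j) * Suc d)) * (P * (1 - x ^ (n + j + 1)))"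
    unfolding gordon_term_def d P1 s_def by metis
  have "x ^ (k * j * Suc n + k * (Suc n)\<^sup>2 + (Suc (Suc n) choose 2) + d * Suc n)
      = m * x ^ (n + (2 * n + 1 + j) * i) * x ^ ((2 * n + 1 + Suc j) * Suc d)"
    unfolding m_def power_add[symmetric] choose_2_Suc[of "Suc n"]
    by (rule arg_cong[where f = "power x"]) (simp add: k algebra_simps power2_eq_square)
  hence "u (Suc n) = - s * (m * x ^ (n + (2 * n + 1 + j) * i) * x ^ ((2 * n + 1 + Suc j) * Suc d)) *
      ((1 - x ^ Suc n) * (\<Prod>t<j. 1 - x ^ (Suc n + t + 1)))"
    unfolding u_def d s_def by (simp only: mult_ac) simp
  hence u1: "u (Suc n) = - s * (m * x ^ (n + (2 * n + 1 + j) * i) * x ^ ((2 * n + 1 + Suc j) * Suc d)) *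
      (P * (1 - x ^ (n + j + 1)))"
    unfolding P2 .
  have e: "x ^ ((2 * n + 1 + j) * Suc i) = x ^ (n + (2 * n + 1 + j) * i) * x ^ (n + j + 1)"
    unfolding power_add[symmetric] by (rule arg_cong[where f = "power x"]) (simp add: algebra_simps)
  have e': "x ^ (n + (2 * n + 1 + j) * i) = x ^ n * x ^ ((2 * n + 1 + j) * i)"
    by (simp add: power_add)
  show ?thesis
    unfolding t1 t0 t2 u0 u1 e e' by (simp add: algebra_simps)
qed

text \<open>Summing the termwise recurrence leaves the error \<open>u 0 - u N\<close>, where
  \<open>u 0\<close> vanishes by its factor \<open>1 - fps_X ^ 0\<close> and \<open>u N\<close> is
  divisible by \<open>fps_X ^ N\<close>.\<close>

lemma gordon_numer_Suc:
  assumes "i < k"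
  shows "gordon_numer k j (Suc i) =
    gordon_numer k j i + fps_X ^ (Suc j * i) * (gordon_numer k (Suc j) (k - i) :: 'a::comm_ring_1 fps)"
proof (rule fps_eqI_cong)
  fix N
  let ?t = "gordon_term (fps_X :: 'a fps)"
  define u where "u = (\<lambda>n. (-1) ^ n * fps_X ^ (k * j * n + k * n\<^sup>2 + (Suc n choose 2) + (k - Suc i) * n)
     * (1 - fps_X ^ n) * (\<Prod>t<j. 1 - fps_X ^ (n + t + 1)) :: 'a fps)"
  have "fps_cong N (gordon_numer k j (Suc i)) (\<Sum>n<N. ?t k j (Suc i) n)"
    by (rule fps_cong_gordon_numer) simp
  also have "(\<Sum>n<N. ?t k j (Suc i) n) =
      (\<Sum>n<N. ?t k j i n + fps_X ^ (Suc j * i) * ?t k (Suc j) (k - i) n + (u n - u (Suc n)))"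
    unfolding u_def by (intro sum.cong refl) (subst gordon_term_Suc[OF assms], simp)
  also have "\<dots> = (\<Sum>n<N. ?t k j i n) + fps_X ^ (Suc j * i) * (\<Sum>n<N. ?t k (Suc j) (k - i) n) + (u 0 - u N)"
    by (simp only: sum.distrib sum_distrib_left sum_lessThan_telescope')
  also have "fps_cong N (u 0 - u N) (0 - 0)"
  proof (intro fps_cong_diff)
    have "N \<le> k * j * N + k * N\<^sup>2 + (Suc N choose 2) + (k - Suc i) * N"
      using le_choose_2[of N] by linarith
    from fps_cong_X_power_0[OF this, of "(-1) ^ N * (1 - fps_X ^ N) * (\<Prod>t<j. 1 - fps_X ^ (N + t + 1))"]
    show "fps_cong N (u N) 0" unfolding u_def by (simp only: mult_ac)
    show "fps_cong N (u 0) 0" by (simp add: u_def)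
  qed
  hence "fps_cong N ((\<Sum>n<N. ?t k j i n) + fps_X ^ (Suc j * i) * (\<Sum>n<N. ?t k (Suc j) (k - i) n) + (u 0 - u N))
     (gordon_numer k j i + fps_X ^ (Suc j * i) * gordon_numer k (Suc j) (k - i) + (0 - 0))"
    by (intro fps_cong_add fps_cong_mult fps_cong_refl fps_cong_sym[OF fps_cong_gordon_numer]) auto
  finally show "fps_cong N (gordon_numer k j (Suc i) :: 'a fps)
      (gordon_numer k j i + fps_X ^ (Suc j * i) * gordon_numer k (Suc j) (k - i))"
    by simp
qed

lemma gordon_numer_0: "gordon_numer k j 0 = 0"
  by (rule fps_eqI_cong) (use fps_cong_gordon_numer[OF order_refl, of _ k j 0] in \<open>simp add: gordon_term_def\<close>)

text \<open>Only the term \<open>n = 0\<close> survives at this precision, and up to a factor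
  congruent to 1 it is Euler's product cut off at \<open>j\<close>. This matches the initial
  condition of \<open>gordon_tail\<close> after division by \<open>euler_fps\<close>.\<close>

lemma fps_cong_gordon_numer_euler:
  assumes "1 \<le> i" "i \<le> k"
  shows "fps_cong (Suc j) (gordon_numer k j i) euler_fps"
proof -
  have "fps_cong (Suc j) (gordon_numer k j i) (\<Sum>n<Suc j. gordon_term fps_X k j i n)"
    by (rule fps_cong_gordon_numer) simp
  also have "fps_cong (Suc j) \<dots> (\<Sum>n<1. gordon_term fps_X k j i n)"
  proof (intro fps_cong_sum_lessThan fps_cong_gordon_term)
    fix n :: nat assume n: "1 \<le> n"
    have "1 \<le> k * n" "j \<le> j * (k * n)" using n assms by simp_all
    moreover have "1 \<le> k * n\<^sup>2" using n assms by simp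
    moreover have "k * j * n = j * (k * n)" by simp
    ultimately show "Suc j \<le> k * j * n + k * n\<^sup>2 + (Suc n choose 2) + (k - i) * n"
      by linarith
  qed simp
  also have "(\<Sum>n<1. gordon_term fps_X k j i n) = (1 - fps_X ^ (Suc j * i)) * euler_prod fps_X j"
    by (simp add: gordon_term_def euler_prod_def binomial_eq_0)
  also have "fps_cong (Suc j) \<dots> (1 * euler_fps)"
    using mult_le_mono2[OF assms(1), of "Suc j"]
    by (intro fps_cong_mult fps_cong_one_minus_X_power fps_cong_sym[OF fps_cong_euler_fps]) simp
  finally show ?thesis by simp
qed

subsection \<open>A finite form of the Jacobi triple product\<close>

text \<open>Gaussian binomial coefficients, defined by a q-Pascal rule so that no division
  occurs.\<close>

fun qbinomial :: "'a::comm_ring_1 \<Rightarrow> nat \<Rightarrow> nat \<Rightarrow> 'a" where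
  "qbinomial q m 0 = 1"
| "qbinomial q 0 (Suc n) = 0"
| "qbinomial q (Suc m) (Suc n) = q ^ Suc n * qbinomial q m (Suc n) + qbinomial q m n"

lemma qbinomial_eq_0: "m < n \<Longrightarrow> qbinomial q m n = 0"
  by (induction q m n rule: qbinomial.induct) auto

text \<open>The quotient formula without division. For \<open>m = Suc (n + d)\<close> the induction
  rests on \<open>q ^ Suc n * (1 - q ^ Suc d) + (1 - q ^ Suc n) = 1 - q ^ Suc m\<close>.\<close>

lemma qbinomial_euler_prod:
  "n \<le> m \<Longrightarrow> qbinomial q m n * (euler_prod q n * euler_prod q (m - n)) = euler_prod q m"
proof (induction q m n rule: qbinomial.induct)
  case (3 q m n)
  show ?case
  proof (cases "n = m")
    case True
    hence "qbinomial q (Suc m) (Suc n) * (euler_prod q (Suc n) * euler_prod q (Suc m - Suc n)) =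
        qbinomial q m n * (euler_prod q n * euler_prod q (m - n)) * (1 - q ^ Suc m)"
      by (simp add: qbinomial_eq_0 euler_prod_Suc mult.assoc)
    also have "\<dots> = euler_prod q (Suc m)" using 3 by (simp add: euler_prod_Suc)
    finally show ?thesis .
  next
    case False
    then obtain d where m: "m = Suc (n + d)" using 3 less_imp_Suc_add[of n m] by auto
    have "qbinomial q m (Suc n) * (euler_prod q (Suc n) * euler_prod q d) = euler_prod q m"
      using 3 m by simp
    moreover have "qbinomial q m n * (euler_prod q n * euler_prod q (Suc d)) = euler_prod q m"
      using 3 m by simp
    moreover have "q ^ Suc n * (1 - q ^ Suc d) * e + (1 - q ^ Suc n) * e = e * (1 - q ^ Suc m)" for e
      by (simp add: m algebra_simps power_add)
    moreover have "qbinomial q (Suc m) (Suc n) * (euler_prod q (Suc n) * euler_prod q (Suc d)) =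
        q ^ Suc n * (1 - q ^ Suc d) * (qbinomial q m (Suc n) * (euler_prod q (Suc n) * euler_prod q d)) +
        (1 - q ^ Suc n) * (qbinomial q m n * (euler_prod q n * euler_prod q (Suc d)))"
      unfolding qbinomial.simps euler_prod_Suc by (simp only: algebra_simps)
    moreover have "Suc m - Suc n = Suc d" by (simp add: m)
    ultimately show ?thesis by (simp only: euler_prod_Suc[of q m])
  qed
qed simp_all

text \<open>Homogeneous form of the q-binomial theorem. The induction removes the factor
  \<open>t = 0\<close> and uses the hypothesis at \<open>z * q\<close>.\<close>

lemma qbinomial_theorem:
  "(\<Prod>t<m. y + z * q ^ t) = (\<Sum>n\<le>m. qbinomial q m n * q ^ (n choose 2) * z ^ n * y ^ (m - n))"
proof (induction m arbitrary: z)
  case (Suc m)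
  let ?f = "\<lambda>n. qbinomial q m n * q ^ (n choose 2) * (z * q) ^ n * y ^ (m - n)"
  have "(\<Prod>t<Suc m. y + z * q ^ t) = (y + z) * (\<Prod>t<m. y + (z * q) * q ^ t)"
    by (subst prod.lessThan_Suc_shift) (simp add: mult_ac)
  also have "\<dots> = y * (\<Sum>n\<le>m. ?f n) + z * (\<Sum>n\<le>m. ?f n)"
    by (simp add: Suc.IH distrib_right)
  \<comment> \<open>The added index \<open>Suc m\<close> contributes 0, since its q-binomial
    coefficient vanishes.\<close>
  also have "y * (\<Sum>n\<le>m. ?f n) = (\<Sum>n\<le>Suc m. y * ?f n)"
    by (simp add: sum_distrib_left qbinomial_eq_0)
  also have "\<dots> = y ^ Suc m + (\<Sum>n\<le>m. y * ?f (Suc n))"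
    by (subst sum.atMost_Suc_shift) (simp add: binomial_eq_0)
  also have "\<dots> + z * (\<Sum>n\<le>m. ?f n) = y ^ Suc m + (\<Sum>n\<le>m. y * ?f (Suc n) + z * ?f n)"
    by (simp add: sum.distrib sum_distrib_left add.assoc)
  also have "(\<Sum>n\<le>m. y * ?f (Suc n) + z * ?f n) =
      (\<Sum>n\<le>m. qbinomial q (Suc m) (Suc n) * q ^ (Suc n choose 2) * z ^ Suc n * y ^ (Suc m - Suc n))"
  proof (rule sum.cong)
    fix n assume "n \<in> {..m}"
    hence n: "n \<le> m" by simp
    have e: "q ^ (Suc n choose 2) = q ^ (n choose 2) * q ^ n"
      unfolding choose_2_Suc by (rule power_add)
    show "y * ?f (Suc n) + z * ?f n =
      qbinomial q (Suc m) (Suc n) * q ^ (Suc n choose 2) * z ^ Suc n * y ^ (Suc m - Suc n)"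
    proof (cases "n = m")
      case True
      thus ?thesis unfolding e by (simp add: qbinomial_eq_0 power_mult_distrib mult_ac)
    next
      case False
      hence "m - n = Suc (m - Suc n)" using n by simp
      thus ?thesis unfolding e by (simp add: power_mult_distrib algebra_simps)
    qed
  qed simp
  also have "y ^ Suc m + \<dots> =
      (\<Sum>n\<le>Suc m. qbinomial q (Suc m) n * q ^ (n choose 2) * z ^ n * y ^ (Suc m - n))"
    by (subst sum.atMost_Suc_shift) (simp add: binomial_eq_0)
  finally show ?case .
qed (simp add: binomial_eq_0)

lemma two_choose_2: "2 * (Suc n choose 2) = n * Suc n"
  by (induction n) (simp_all add: choose_2_Suc binomial_eq_0)

lemma choose_2_add: "(m + n) choose 2 = (m choose 2) + (n choose 2) + m * n"
  by (induction n) (simp_all add: choose_2_Suc binomial_eq_0)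

lemma finite_jacobi_triple_product:
  fixes M g L :: nat
  assumes "g \<le> M"
  defines "x \<equiv> fps_X :: 'a::field fps"
  shows "(\<Prod>m<L. (1 - x ^ (M * m + g)) * (1 - x ^ (M * Suc m - g))) =
    (\<Sum>n\<le>L. (-1) ^ n * x ^ (M * (Suc n choose 2) - g * n) * qbinomial (x ^ M) (2 * L) (L - n)) +
    (\<Sum>n<L. (-1) ^ Suc n * x ^ (M * (Suc n choose 2) + g * Suc n) * qbinomial (x ^ M) (2 * L) (Suc (L + n)))"
    (is "?J = ?A + ?B")
proof -
  \<comment> \<open>This is the q-binomial theorem for \<open>2 * L\<close> factors with \<open>y = x ^ (M * L)\<close>, \<open>z = - x ^ g\<close> and base
    \<open>x ^ M\<close>; the monomial \<open>c\<close> clears the negative exponents.\<close>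
  define K where "K = M * (L choose 2) + g * L + M * L * L"
  define c where "c = (-1) ^ L * x ^ K"
  let ?f = "\<lambda>n. qbinomial (x ^ M) (2 * L) n * (x ^ M) ^ (n choose 2) * (- (x ^ g)) ^ n * (x ^ (M * L)) ^ (2 * L - n)"
  let ?h = "\<lambda>t. x ^ (M * L) + - (x ^ g) * (x ^ M) ^ t"
  have gn: "g * n \<le> M * (Suc n choose 2)" for n
    using mult_le_mono[OF assms(1) le_choose_2] .
  have f_eq: "?f n = (-1) ^ n * x ^ (M * (n choose 2) + g * n + M * L * (2 * L - n)) * qbinomial (x ^ M) (2 * L) n" for n
  proof -
    have "(- (x ^ g)) ^ n = (-1) ^ n * x ^ (g * n)"
      by (subst power_minus) (simp add: power_mult)
    thus ?thesis by (simp add: power_add power_mult mult_ac)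
  qed
  have "(\<Prod>t<2 * L. ?h t) = (\<Prod>t<L. ?h t) * (\<Prod>t<L. ?h (L + t))"
    by (simp add: mult_2 prod.atLeastLessThan_concat[symmetric, of 0 L "L + L"] lessThan_atLeast0
      prod.shift_bounds_nat_ivl[of _ 0 L L, simplified] add.commute)
  also have "(\<Prod>t<L. ?h (L + t)) = (\<Prod>t<L. x ^ (M * L) * (1 - x ^ (M * t + g)))"
  proof (rule prod.cong)
    fix t
    have "x ^ g * (x ^ M) ^ (L + t) = x ^ (M * L) * x ^ (M * t + g)"
      unfolding power_mult[symmetric] power_add[symmetric]
      by (rule arg_cong[where f = "power x"]) (simp add: algebra_simps)
    thus "?h (L + t) = x ^ (M * L) * (1 - x ^ (M * t + g))" by (simp add: right_diff_distrib)
  qed simp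
  also have "\<dots> = x ^ (M * L * L) * (\<Prod>t<L. 1 - x ^ (M * t + g))"
    by (simp add: prod.distrib power_mult)
  \<comment> \<open>In the lower half the second summand has the smaller exponent and is factored
    out; reversing the factors then gives the second family in \<open>?J\<close>.\<close>
  also have "(\<Prod>t<L. ?h t) = (\<Prod>t<L. - (x ^ (M * t + g)) * (1 - x ^ (M * Suc (L - Suc t) - g)))"
  proof (rule prod.cong)
    fix t assume "t \<in> {..<L}"
    hence t: "t < L" by simp
    define a where "a = M * Suc (L - Suc t) - g"
    have "L = t + Suc (L - Suc t)" using t by simp
    hence "M * L = M * t + M * Suc (L - Suc t)" by (metis distrib_left)
    moreover have "g \<le> M * Suc (L - Suc t)" using assms(1) by simp
    ultimately have "M * L = M * t + g + a" by (simp add: a_def)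
    hence "x ^ (M * L) = x ^ (M * t + g) * x ^ a" by (simp add: power_add)
    thus "?h t = - (x ^ (M * t + g)) * (1 - x ^ (M * Suc (L - Suc t) - g))"
      unfolding a_def[symmetric] by (simp add: algebra_simps power_add power_mult)
  qed simp
  also have "\<dots> = (\<Prod>t<L. - (x ^ (M * t + g))) * (\<Prod>t<L. 1 - x ^ (M * Suc t - g))"
    by (simp only: prod.distrib prod.nat_diff_reindex[where g = "\<lambda>t. 1 - x ^ (M * Suc t - g)"])
  also have "(\<Prod>t<L. - (x ^ (M * t + g))) = (-1) ^ L * x ^ (M * (L choose 2) + g * L)"
    by (induction L) (simp_all add: choose_2_Suc binomial_eq_0 power_add algebra_simps)
  finally have "(\<Prod>t<2 * L. ?h t) = c * ?J"
    by (simp add: c_def K_def prod.distrib power_add mult_ac)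
  also have "(\<Prod>t<2 * L. ?h t) = (\<Sum>n\<le>2 * L. ?f n)" by (rule qbinomial_theorem)
  \<comment> \<open>Centring the sum at \<open>L\<close> yields the two halves of the bilateral
    theta series.\<close>
  also have "\<dots> = (\<Sum>n\<le>L. ?f (L - n)) + (\<Sum>n<L. ?f (Suc (L + n)))"
  proof -
    have "(\<Sum>n\<le>2 * L. ?f n) = (\<Sum>n\<le>L. ?f n) + (\<Sum>n\<in>{L<..2 * L}. ?f n)"
      by (subst sum.union_disjoint[symmetric]) (auto intro!: sum.cong)
    also have "(\<Sum>n\<le>L. ?f n) = (\<Sum>n\<le>L. ?f (L - n))"
      by (rule sum.reindex_bij_witness[of _ "\<lambda>n. L - n" "\<lambda>n. L - n"]) auto
    also have "(\<Sum>n\<in>{L<..2 * L}. ?f n) = (\<Sum>n<L. ?f (Suc (L + n)))"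
      by (rule sum.reindex_bij_witness[of _ "\<lambda>n. Suc (L + n)" "\<lambda>n. n - Suc L"]) auto
    finally show ?thesis .
  qed
  also have "(\<Sum>n\<le>L. ?f (L - n)) = c * ?A"
    unfolding sum_distrib_left
  proof (rule sum.cong)
    fix n assume "n \<in> {..L}"
    then obtain d where L: "L = d + n" by (metis atMost_iff le_add_diff_inverse2)
    have "n * n = n + (n choose 2) + (n choose 2)"
      using two_choose_2[of n] by (simp add: choose_2_Suc)
    hence "M * (n * n) = M * n + M * (n choose 2) + M * (n choose 2)"
      by (simp only: distrib_left)
    hence "M * (d choose 2) + g * d + M * L * (2 * L - d) + g * n
        = K + M * (Suc n choose 2)"
      by (simp add: K_def L choose_2_add choose_2_Suc algebra_simps)
    hence "M * (d choose 2) + g * d + M * L * (2 * L - d) = K + (M * (Suc n choose 2) - g * n)"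
      using gn[of n] by linarith
    hence "?f d = (-1) ^ d * (x ^ K * x ^ (M * (Suc n choose 2) - g * n)) * qbinomial (x ^ M) (2 * L) d"
      unfolding f_eq by (simp add: power_add)
    moreover have "(-1) ^ d = (-1) ^ L * (-1 :: 'a fps) ^ n"
      by (simp add: L power_add mult.assoc flip: power_mult_distrib)
    ultimately show "?f (L - n) = c * ((-1) ^ n * x ^ (M * (Suc n choose 2) - g * n) * qbinomial (x ^ M) (2 * L) (L - n))"
      by (simp add: c_def L mult_ac)
  qed simp
  also have "(\<Sum>n<L. ?f (Suc (L + n))) = c * ?B"
    unfolding sum_distrib_left
  proof (rule sum.cong)
    fix n assume "n \<in> {..<L}"
    then obtain d where L: "L = Suc n + d" by (metis lessThan_iff less_imp_Suc_add add_Suc)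
    have "2 * L - Suc (L + n) = d" by (simp add: L)
    moreover have "M * (Suc (L + n) choose 2) + g * Suc (L + n) + M * L * d
        = K + (M * (Suc n choose 2) + g * Suc n)"
      using choose_2_add[of L "Suc n"] by (simp add: K_def L algebra_simps)
    ultimately have "?f (Suc (L + n)) = (-1) ^ Suc (L + n) *
        (x ^ K * x ^ (M * (Suc n choose 2) + g * Suc n)) * qbinomial (x ^ M) (2 * L) (Suc (L + n))"
      unfolding f_eq by (simp only: power_add)
    thus "?f (Suc (L + n)) = c * ((-1) ^ Suc n * x ^ (M * (Suc n choose 2) + g * Suc n)
        * qbinomial (x ^ M) (2 * L) (Suc (L + n)))"
      by (simp add: c_def power_add mult_ac)
  qed simp
  finally have "c * ?J = c * (?A + ?B)" by (simp only: distrib_left)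
  moreover have "c \<noteq> 0" by (simp add: c_def x_def)
  ultimately show ?thesis using mult_left_cancel by blast
qed

text \<open>By the quotient formula only Euler products of lengths \<open>2 * L\<close>,
  \<open>a\<close>, \<open>b\<close> and \<open>L\<close> are involved, and at precision
  \<open>Suc c\<close> all of them agree with the one of length \<open>c\<close>.\<close>

lemma fps_cong_qbinomial:
  fixes M L a b :: nat
  assumes "M > 0" "a + b = 2 * L" "c \<le> a" "c \<le> b"
  defines "q \<equiv> fps_X ^ M :: 'a::field fps"
  shows "fps_cong (Suc c) (euler_prod q L * qbinomial q (2 * L) a) 1"
proof (rule fps_cong_mult_cancel)
  have euler: "fps_cong (Suc c) (euler_prod q n) (euler_prod q c)" if "c \<le> n" for n
    unfolding q_def using assms(1) that by (rule fps_cong_euler_prod)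
  note euler' = euler[THEN fps_cong_sym]
  \<comment> \<open>With a second factor \<open>euler_prod q L\<close>, cancelled at the end, both
    denominators of the quotient formula can be formed.\<close>
  have "fps_cong (Suc c) (euler_prod q L * (euler_prod q L * qbinomial q (2 * L) a))
     (euler_prod q c * (euler_prod q c * qbinomial q (2 * L) a))"
    using assms by (intro fps_cong_mult euler fps_cong_refl) auto
  also have "fps_cong (Suc c) \<dots> (euler_prod q a * (euler_prod q b * qbinomial q (2 * L) a))"
    using assms by (intro fps_cong_mult euler' fps_cong_refl) auto
  also have "\<dots> = qbinomial q (2 * L) a * (euler_prod q a * euler_prod q (2 * L - a))"
  proof -
    have "2 * L - a = b" using assms(2) by simp
    thus ?thesis by (simp only: mult_ac)
  qed
  also have "\<dots> = euler_prod q (2 * L)" using assms(2) by (intro qbinomial_euler_prod) simp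
  also have "fps_cong (Suc c) \<dots> (euler_prod q c)" using assms by (intro euler) auto
  also have "fps_cong (Suc c) \<dots> (euler_prod q L)" using assms by (intro euler') auto
  finally show "fps_cong (Suc c) (euler_prod q L * (euler_prod q L * qbinomial q (2 * L) a)) (euler_prod q L * 1)"
    by simp
  show "fps_nth (euler_prod q L) 0 \<noteq> 0"
    unfolding q_def using assms(1) by (simp add: euler_prod_nth_0)
qed

text \<open>The monomial raises the precision by \<open>e\<close>, which compensates for the low
  precision of the outer q-binomial coefficients.\<close>

lemma fps_cong_X_power_mult:
  assumes "fps_cong N v w" "L \<le> e + N"
  shows "fps_cong L (s * fps_X ^ e * v) (s * fps_X ^ e * w)"
proof -
  have "fps_X ^ (e + N) dvd fps_X ^ e * (v - w)"
    using assms(1) by (simp add: fps_cong_def power_add mult_dvd_mono)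
  hence "fps_X ^ L dvd s * (fps_X ^ e * (v - w))"
    using assms(2) by (meson dvd_mult dvd_trans le_imp_power_dvd)
  thus ?thesis by (simp add: fps_cong_def right_diff_distrib mult.assoc)
qed

text \<open>After multiplication by \<open>euler_prod (x ^ M) L\<close> the q-binomial coefficients
  in the finite identity become 1. The one at distance \<open>n\<close> from the centre is exact
  only to order about \<open>L - n\<close>, but its monomial has degree at least
  \<open>n\<close>.\<close>

lemma jacobi_triple_product_cong:
  fixes k g L :: nat
  assumes "1 \<le> g" "g \<le> k"
  defines "x \<equiv> fps_X :: 'a::field fps" and "M \<equiv> 2 * k + 1"
  shows "fps_cong L (euler_prod (x ^ M) L * (\<Prod>m<L. (1 - x ^ (M * m + g)) * (1 - x ^ (M * Suc m - g))))
    (gordon_numer k 0 g)"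
proof -
  let ?p = "euler_prod (x ^ M) L" and ?b = "qbinomial (x ^ M) (2 * L)"
  let ?e = "\<lambda>n. M * (Suc n choose 2) - g * n" and ?e' = "\<lambda>n. M * (Suc n choose 2) + g * Suc n"
  have M: "g \<le> M" "M > 0" using assms by auto
  have e: "?e n = k * n\<^sup>2 + (Suc n choose 2) + (k - g) * n" for n
  proof -
    have "M * (Suc n choose 2) = k * (n * Suc n) + (Suc n choose 2)"
      unfolding two_choose_2[symmetric] by (simp add: M_def algebra_simps)
    moreover have "k * n = (k - g) * n + g * n" using assms(2) by (simp flip: distrib_right)
    moreover have "k * (n * Suc n) = k * n\<^sup>2 + k * n"
      by (simp add: power2_eq_square algebra_simps)
    ultimately have "M * (Suc n choose 2) = (k * n\<^sup>2 + (Suc n choose 2) + (k - g) * n) + g * n"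
      by linarith
    thus ?thesis by simp
  qed
  have le_e: "n \<le> ?e n" for n using e[of n] le_choose_2[of n] by linarith
  have e': "?e' n = ?e n + (2 * n + 1) * g" for n
  proof -
    have "g * n \<le> M * (Suc n choose 2)" using M(1) le_choose_2 by (rule mult_le_mono)
    thus ?thesis by (simp add: algebra_simps)
  qed
  \<comment> \<open>The terms of equal index in the two sums combine to \<open>gordon_term\<close>
    with \<open>j = 0\<close>; the unpaired term \<open>n = L\<close> has degree at least
    \<open>L\<close>.\<close>
  have sum_eq: "(\<Sum>n\<le>L. (-1) ^ n * x ^ ?e n * 1) + (\<Sum>n<L. (-1) ^ Suc n * x ^ ?e' n * 1) =
      (\<Sum>n<L. gordon_term x k 0 g n) + (-1) ^ L * x ^ ?e L"
  proof -
    have "gordon_term x k 0 g n = (-1) ^ n * x ^ ?e n + (-1) ^ Suc n * x ^ ?e' n" for n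
    proof -
      have "gordon_term x k 0 g n = (-1) ^ n * x ^ ?e n * (1 - x ^ ((2 * n + 1) * g))"
        unfolding e by (simp add: gordon_term_def)
      thus ?thesis unfolding e' power_add by (simp add: right_diff_distrib mult.assoc)
    qed
    moreover have "(\<Sum>n\<le>L. (-1) ^ n * x ^ ?e n) = (\<Sum>n<L. (-1) ^ n * x ^ ?e n) + (-1) ^ L * x ^ ?e L"
      unfolding lessThan_Suc_atMost[symmetric] by (rule sum.lessThan_Suc)
    ultimately show ?thesis by (simp only: sum.distrib mult_1_right add_ac)
  qed
  have "?p * (\<Prod>m<L. (1 - x ^ (M * m + g)) * (1 - x ^ (M * Suc m - g))) =
      (\<Sum>n\<le>L. (-1) ^ n * x ^ ?e n * (?p * ?b (L - n))) +
      (\<Sum>n<L. (-1) ^ Suc n * x ^ ?e' n * (?p * ?b (Suc (L + n))))"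
    unfolding x_def finite_jacobi_triple_product[OF M(1)] distrib_left sum_distrib_left
    by (intro arg_cong2[where f = "(+)"] sum.cong refl) (simp_all only: mult_ac)
  also have "fps_cong L \<dots> ((\<Sum>n\<le>L. (-1) ^ n * x ^ ?e n * 1) + (\<Sum>n<L. (-1) ^ Suc n * x ^ ?e' n * 1))"
  proof (intro fps_cong_add fps_cong_sum)
    fix n assume "n \<in> {..L}"
    hence n: "n \<le> L" by simp
    have "fps_cong (Suc (L - n)) (?p * ?b (L - n)) 1"
      unfolding x_def using M(2) n by (intro fps_cong_qbinomial[where b = "L + n"]) auto
    moreover have "L \<le> ?e n + Suc (L - n)"
    proof -
      have "L \<le> n + Suc (L - n)" by simp
      also have "\<dots> \<le> ?e n + Suc (L - n)" using le_e by (rule add_right_mono)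
      finally show ?thesis .
    qed
    ultimately show "fps_cong L ((-1) ^ n * x ^ ?e n * (?p * ?b (L - n))) ((-1) ^ n * x ^ ?e n * 1)"
      unfolding x_def by (rule fps_cong_X_power_mult)
  next
    fix n assume "n \<in> {..<L}"
    hence n: "Suc n \<le> L" by simp
    have "fps_cong (Suc (L - Suc n)) (?p * ?b (Suc (L + n))) 1"
      unfolding x_def using M(2) n by (intro fps_cong_qbinomial[where b = "L - Suc n"]) auto
    moreover have "L \<le> ?e' n + Suc (L - Suc n)"
      using le_e[of n] e'[of n] by linarith
    ultimately show "fps_cong L ((-1) ^ Suc n * x ^ ?e' n * (?p * ?b (Suc (L + n)))) ((-1) ^ Suc n * x ^ ?e' n * 1)"
      unfolding x_def by (rule fps_cong_X_power_mult)
  qed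
  also note sum_eq
  also have "fps_cong L ((\<Sum>n<L. gordon_term x k 0 g n) + (-1) ^ L * x ^ ?e L) (gordon_numer k 0 g + 0)"
  proof (rule fps_cong_add)
    show "fps_cong L (\<Sum>n<L. gordon_term x k 0 g n) (gordon_numer k 0 g)"
      unfolding x_def by (rule fps_cong_sym[OF fps_cong_gordon_numer]) simp
    show "fps_cong L ((-1) ^ L * x ^ ?e L) 0"
      unfolding x_def mult.commute[of "(-1) ^ L"] by (rule fps_cong_X_power_0[OF le_e])
  qed
  finally show ?thesis by simp
qed

section \<open>Gordon's product and the excluded residue classes\<close>

lemma gordon_factor_mult:
  assumes "n > 0"
  shows "(1 - fps_X ^ n) * (1 / (1 - fps_X ^ n)) = (1 :: 'a::field fps)"
  using assms by (simp add: fps_divide_unit inverse_mult_eq_1')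

lemma fps_cong_gordon_factor: "n > 0 \<Longrightarrow> fps_cong n (gordon_factor k i n) 1"
proof -
  assume n: "n > 0"
  have "fps_cong n ((1 - fps_X ^ n) * (1 / (1 - fps_X ^ n))) ((1 - fps_X ^ n) * 1 :: 'a fps)"
    unfolding gordon_factor_mult[OF n] mult_1_right
    by (rule fps_cong_sym[OF fps_cong_one_minus_X_power]) simp
  hence "fps_cong n (1 / (1 - fps_X ^ n)) (1 :: 'a fps)"
    by (rule fps_cong_mult_cancel) (use n in simp)
  thus ?thesis by (simp add: gordon_factor_def)
qed

text \<open>Each coefficient of the limit is that of some long partial product, whose factors beyond
  the first \<open>N\<close> are 1 at precision \<open>N\<close>.\<close>

lemma fps_cong_gordon_product:
  "fps_cong N (gordon_product k i :: 'a::field_char_0 fps) (\<Prod>n<N. gordon_factor k i (Suc n))"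
  unfolding fps_cong_iff
proof (intro allI impI)
  fix m assume m: "m < N"
  let ?P = "\<lambda>T. \<Prod>n<T. gordon_factor k i (Suc n) :: 'a fps"
  have "?P \<longlonglongrightarrow> gordon_product k i"
    using gordon_factor_has_prod by (rule has_prod_imp_tendsto')
  hence "eventually (\<lambda>T. fps_nth (?P T) m = fps_nth (gordon_product k i) m) sequentially"
    by (simp add: tendsto_fps_iff)
  hence "eventually (\<lambda>T. fps_nth (?P T) m = fps_nth (gordon_product k i) m \<and> N \<le> T) sequentially"
    using eventually_ge_at_top by (rule eventually_conj)
  then obtain T where T: "fps_nth (?P T) m = fps_nth (gordon_product k i) m" "N \<le> T"
    by (auto simp: eventually_sequentially)
  have "fps_cong N (?P T) (?P N)"
    using T(2) by (intro fps_cong_prod_lessThan fps_cong_mono[OF fps_cong_gordon_factor]) auto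
  thus "fps_nth (gordon_product k i :: 'a fps) m = fps_nth (?P N) m"
    using T m by (simp add: fps_cong_iff)
qed

text \<open>Multiplication by \<open>1 - fps_X ^ m\<close> cancels the factors in the allowed
  classes and leaves those in the excluded ones; \<open>- g\<close> and \<open>M - g\<close> are the
  same class.\<close>

lemma gordon_factor_eq:
  assumes "1 \<le> i" "i \<le> k" "m > 0"
  defines "M \<equiv> 2 * k + 1" and "g \<equiv> k + 1 - i"
  shows "(1 - fps_X ^ m) * gordon_factor k i m =
    (if m mod M \<in> {0, g, M - g} then 1 - fps_X ^ m else 1 :: 'a::field_char_0 fps)"
proof -
  have M: "2 * int k + 1 = int M" and g: "int k + 1 - int i = int g"
    using assms(2) by (auto simp: M_def g_def)
  have gM: "g < M" "g > 0" using assms(1,2) by (auto simp: M_def g_def)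
  have "[- int g = int M - int g] (mod int M)" by (simp add: cong_def)
  hence "[int m = - int g] (mod int M) \<longleftrightarrow> [int m = int (M - g)] (mod int M)"
    using gM by (simp add: of_nat_diff less_imp_le) (meson cong_sym cong_trans)
  hence "([int m = 0] (mod int M) \<or> [int m = int g] (mod int M) \<or> [int m = - int g] (mod int M))
      \<longleftrightarrow> m mod M \<in> {0, g, M - g}"
    using gM cong_int_iff[of m 0 M] cong_int_iff[of m g M] cong_int_iff[of m "M - g" M]
    by (auto simp: cong_def)
  thus ?thesis
    unfolding gordon_factor_def M g using gordon_factor_mult[OF assms(3), where 'a = 'a] by simp
qed

text \<open>Euler's product times Gordon's product keeps only the exponents in the classes
  \<open>0\<close>, \<open>g\<close> and \<open>M - g\<close> modulo \<open>M\<close>, which is the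
  product side of the Jacobi triple product.\<close>

lemma euler_fps_gordon_product:
  fixes k i :: nat
  assumes "1 \<le> i" "i \<le> k"
  shows "euler_fps * gordon_product k i = (gordon_numer k 0 (k + 1 - i) :: 'a::field_char_0 fps)"
proof (rule fps_eqI_cong)
  fix L
  define M where "M = 2 * k + 1"
  define g where "g = k + 1 - i"
  define x where "x = (fps_X :: 'a fps)"
  define h where "h = (\<lambda>m. if m mod M \<in> {0, g, M - g} then 1 - x ^ m else 1)"
  have g: "1 \<le> g" "g \<le> k" "g < M - g" "M - g < M" using assms by (auto simp: M_def g_def)
  \<comment> \<open>Among \<open>M\<close> consecutive exponents exactly three contribute; they are
    distinct because \<open>0 < g < M - g < M\<close>.\<close>
  have block: "(\<Prod>n\<in>{m * M..<m * M + M}. h (Suc n)) =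
      (1 - x ^ (M * m + g)) * (1 - x ^ (M * Suc m - g)) * (1 - (x ^ M) ^ Suc m)" for m
  proof -
    have "(\<Prod>n\<in>{m * M..<m * M + M}. h (Suc n)) = (\<Prod>n\<in>{m * M + g - 1, m * M + (M - g) - 1, m * M + M - 1}. h (Suc n))"
    proof (rule prod.mono_neutral_right)
      show "\<forall>n\<in>{m * M..<m * M + M} - {m * M + g - 1, m * M + (M - g) - 1, m * M + M - 1}. h (Suc n) = 1"
      proof
        fix n assume n: "n \<in> {m * M..<m * M + M} - {m * M + g - 1, m * M + (M - g) - 1, m * M + M - 1}"
        define r where "r = Suc n - m * M"
        have "Suc n = m * M + r" "r < M" "r \<noteq> 0" "r \<noteq> g" "r \<noteq> M - g" using n g by (auto simp: r_def)
        thus "h (Suc n) = 1" by (simp add: h_def)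
      qed
    qed (use g in auto)
    also have "\<dots> = h (m * M + g) * h (m * M + (M - g)) * h (m * M + M)"
    proof -
      have "m * M + g - 1 \<noteq> m * M + (M - g) - 1" "m * M + g - 1 \<noteq> m * M + M - 1"
        "m * M + (M - g) - 1 \<noteq> m * M + M - 1"
        using g by linarith+
      moreover have "Suc (m * M + g - 1) = m * M + g" "Suc (m * M + (M - g) - 1) = m * M + (M - g)"
        "Suc (m * M + M - 1) = m * M + M"
        using g by linarith+
      ultimately show ?thesis by (simp only: prod.insert finite.intros insert_iff empty_iff
        prod.empty mult_1_right mult.assoc not_False_eq_True simp_thms)
    qed
    also have "h (m * M + g) = 1 - x ^ (M * m + g)"
      using g by (simp add: h_def mult.commute)
    also have "h (m * M + (M - g)) = 1 - x ^ (M * Suc m - g)"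
    proof -
      have "(m * M + (M - g)) mod M = M - g"
        unfolding mod_mult_self3 using g(4) by (rule mod_less)
      moreover have "m * M + (M - g) = M * Suc m - g" using g by (simp add: mult.commute)
      ultimately show ?thesis by (simp only: h_def insert_iff simp_thms if_True)
    qed
    also have "h (m * M + M) = 1 - (x ^ M) ^ Suc m"
    proof -
      have "(m * M + M) mod M = 0" "m * M + M = M * Suc m" by simp_all
      thus ?thesis by (simp only: h_def insert_iff simp_thms if_True power_mult)
    qed
    finally show ?thesis .
  qed
  \<comment> \<open>Cutting off at \<open>L * M\<close> leaves \<open>L\<close> complete
    blocks.\<close>
  have "euler_prod x (L * M) * (\<Prod>n<L * M. gordon_factor k i (Suc n)) =
      (\<Prod>n<L * M. (1 - x ^ Suc n) * gordon_factor k i (Suc n))"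
    unfolding euler_prod_def by (rule prod.distrib[symmetric])
  also have "\<dots> = (\<Prod>n<L * M. h (Suc n))"
    unfolding h_def x_def M_def g_def
    by (rule prod.cong[OF refl], rule gordon_factor_eq[OF assms]) simp
  also have "\<dots> = (\<Prod>m<L. \<Prod>n\<in>{m * M..<m * M + M}. h (Suc n))"
    by (rule prod.nat_group[symmetric])
  also have "\<dots> = (\<Prod>m<L. (1 - x ^ (M * m + g)) * (1 - x ^ (M * Suc m - g))) * euler_prod (x ^ M) L"
    unfolding euler_prod_def block by (rule prod.distrib)
  also note mult.commute
  finally have prod_eq: "euler_prod x (L * M) * (\<Prod>n<L * M. gordon_factor k i (Suc n)) =
      euler_prod (x ^ M) L * (\<Prod>m<L. (1 - x ^ (M * m + g)) * (1 - x ^ (M * Suc m - g)))" .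
  have "L \<le> L * M" by (simp add: M_def)
  moreover have "fps_cong (L * M) (euler_fps * gordon_product k i)
      (euler_prod x (L * M) * (\<Prod>n<L * M. gordon_factor k i (Suc n)))"
    unfolding x_def
    by (rule fps_cong_mult[OF fps_cong_mono[OF fps_cong_euler_fps] fps_cong_gordon_product]) simp
  ultimately have "fps_cong L (euler_fps * gordon_product k i)
      (euler_prod x (L * M) * (\<Prod>n<L * M. gordon_factor k i (Suc n)))"
    using fps_cong_mono by blast
  also note prod_eq
  also have "fps_cong L (euler_prod (x ^ M) L * (\<Prod>m<L. (1 - x ^ (M * m + g)) * (1 - x ^ (M * Suc m - g))))
      (gordon_numer k 0 g)"
    unfolding x_def M_def using g(1,2) by (rule jacobi_triple_product_cong)
  finally show "fps_cong L (euler_fps * gordon_product k i :: 'a fps) (gordon_numer k 0 (k + 1 - i))"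
    by (simp add: g_def)
qed

subsection \<open>Gordon's theorem and the matrix decomposition\<close>

text \<open>
  The only coefficient not directly pushed up by a power of \<open>X\<close> is \<open>D j 1 = D (j + 1) k\<close>, so the inner
  induction runs downwards on \<open>j\<close>, starting where \<open>low\<close> applies.
\<close>

lemma gordon_recurrence_zero:
  fixes D :: "nat \<Rightarrow> nat \<Rightarrow> 'a::comm_ring_1 fps"
  assumes zero: "\<And>j. D j 0 = 0"
    and rec: "\<And>j i. i < k \<Longrightarrow> D j (Suc i) = D j i + fps_X ^ (Suc j * i) * D (Suc j) (k - i)"
    and low: "\<And>j i. i \<le> k \<Longrightarrow> fps_cong (Suc j) (D j i) 0"
    and "i \<le> k"
  shows "D j i = 0"
proof (rule fps_eqI_cong)
  fix N
  show "fps_cong N (D j i) 0" using \<open>i \<le> k\<close>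
  proof (induction N arbitrary: j i)
    case outer: (Suc N)
    show ?case using outer.prems
    proof (induction "N - j" arbitrary: j i rule: less_induct)
      case less
      show ?case
      proof (cases "N \<le> j")
        case True
        thus ?thesis using fps_cong_mono[OF low[OF less.prems, of j], of "Suc N"] by simp
      next
        case False
        show ?thesis using less.prems
        proof (induction i)
          case (Suc i)
          \<comment> \<open>For \<open>i = 0\<close> the downward induction on \<open>j\<close>
            applies; otherwise the monomial has positive degree and lifts precision \<open>N\<close>
            to \<open>Suc N\<close>.\<close>
          have "fps_cong (Suc N) (fps_X ^ (Suc j * i) * D (Suc j) (k - i)) 0"
          proof (cases "i = 0")
            case True
            thus ?thesis using less.hyps[of "Suc j" k] False by simp
          next
            case i: False
            have "fps_cong N (D (Suc j) (k - i)) 0" by (rule outer.IH) simp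
            hence "fps_X ^ (Suc j * i + N) dvd fps_X ^ (Suc j * i) * D (Suc j) (k - i)"
              by (simp add: fps_cong_def power_add mult_dvd_mono)
            moreover have "Suc N \<le> Suc j * i + N" using i by simp
            ultimately show ?thesis by (simp only: fps_cong_def diff_zero) (meson dvd_trans le_imp_power_dvd)
          qed
          moreover have "fps_cong (Suc N) (D j i) 0" using Suc by simp
          ultimately have "fps_cong (Suc N) (D j i + fps_X ^ (Suc j * i) * D (Suc j) (k - i)) (0 + 0)"
            by (intro fps_cong_add)
          thus ?case using Suc.prems by (simp add: rec)
        qed (simp add: zero)
      qed
    qed
  qed (simp add: fps_cong_def)
qed

text \<open>Gordon's theorem, the generalization of the Rogers-Ramanujan identities: the partition
  series and Andrews' series satisfy the same recurrence and initial conditions.\<close>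

lemma gordon_tail_eq_gordon_product:
  fixes k i :: nat
  assumes "1 \<le> i" "i \<le> k"
  shows "gordon_tail k 0 (k + 1 - i) = (gordon_product k i :: 'a::field_char_0 fps)"
proof -
  \<comment> \<open>Comparing after multiplication by \<open>euler_fps\<close> avoids a quotient of
    series; the factor is cancelled at the end.\<close>
  define D where "D = (\<lambda>j i. euler_fps * gordon_tail k j i - gordon_numer k j i :: 'a fps)"
  have "D 0 (k + 1 - i) = 0"
  proof (rule gordon_recurrence_zero[where D = D and k = k])
    show "D j 0 = 0" for j by (simp add: D_def gordon_tail_0 gordon_numer_0)
    show "D j (Suc i) = D j i + fps_X ^ (Suc j * i) * D (Suc j) (k - i)" if "i < k" for i j
      unfolding D_def gordon_tail_Suc[OF that] gordon_numer_Suc[OF that]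
      by (simp only: algebra_simps)
    show "fps_cong (Suc j) (D j i) 0" if "i \<le> k" for i j
    proof (cases "i = 0")
      case True
      thus ?thesis by (simp add: D_def gordon_tail_0 gordon_numer_0)
    next
      case False
      have "fps_cong (Suc j) (gordon_tail k j i) (1 :: 'a fps)"
        using False by (simp add: fps_cong_iff gordon_tail_nth)
      hence "fps_cong (Suc j) (D j i) (euler_fps * 1 - euler_fps)"
        unfolding D_def using False that
        by (intro fps_cong_diff fps_cong_mult fps_cong_gordon_numer_euler fps_cong_refl) auto
      thus ?thesis by simp
    qed
  qed (use assms in simp)
  hence "euler_fps * gordon_tail k 0 (k + 1 - i) = euler_fps * (gordon_product k i :: 'a fps)"
    using euler_fps_gordon_product[OF assms, where 'a = 'a] by (simp add: D_def)
  thus ?thesis using euler_fps_nonzero mult_left_cancel by blast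
qed

text \<open>For \<open>l > 1\<close> the defining recursion of \<open>gordon_G\<close> is
  \<open>gordon_tail_Suc\<close> at \<open>i = l - 1\<close>, solved for its last series.\<close>

lemma gordon_G_eq_gordon_tail:
  assumes "k \<ge> 2" "1 \<le> l" "l \<le> k"
  shows "gordon_G k ((k - 1) * j + l) = (fps_to_fls (gordon_tail k j (k + 1 - l)) :: 'a::field_char_0 fls)"
  using assms(2,3)
proof (induction j arbitrary: l)
  case 0
  thus ?case using gordon_tail_eq_gordon_product[of l k, where 'a = 'a] by (simp add: gordon_G_base)
next
  case (Suc j)
  show ?case
  proof (cases "l = 1")
    case True
    \<comment> \<open>Consecutive levels overlap in this index. On the partition side, having no
      part \<open>Suc j\<close> is the same as having all parts above \<open>Suc j\<close>.\<close>
    have "(k - 1) * Suc j + l = (k - 1) * j + k" using True assms(1) by simp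
    hence "gordon_G k ((k - 1) * Suc j + l) = (fps_to_fls (gordon_tail k j 1) :: 'a fls)"
      using Suc.IH[of k] assms(1) by simp
    also have "gordon_tail k j 1 = (gordon_tail k (Suc j) k :: 'a fps)"
      using gordon_tail_Suc[of 0 k j, where 'a = 'a] assms(1) by (simp add: gordon_tail_0)
    finally show ?thesis using True by simp
  next
    case False
    then obtain d where l: "l = Suc d" "d > 0" using Suc.prems by (cases l) auto
    have d: "d < k" using Suc.prems l by simp
    have ind: "(k - 1) * (Suc j - 1) + k - l + 1 = (k - 1) * j + (k - l + 1)"
      "(k - 1) * (Suc j - 1) + k - l + 2 = (k - 1) * j + (k - l + 2)"
      using Suc.prems by auto
    have "gordon_G k ((k - 1) * Suc j + l) =
        (gordon_G k ((k - 1) * j + (k - l + 1)) - gordon_G k ((k - 1) * j + (k - l + 2)))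
          / (fls_X ^ ((l - 1) * Suc j) :: 'a fls)"
      using gordon_G_rec[of "Suc j" l k] Suc.prems False unfolding ind by simp
    also have "\<dots> = (fps_to_fls (gordon_tail k j (Suc d)) - fps_to_fls (gordon_tail k j d)) / fls_X ^ (Suc j * d)"
    proof -
      have "k + 1 - (k - l + 1) = Suc d" "k + 1 - (k - l + 2) = d" "(l - 1) * Suc j = Suc j * d"
        using l d by auto
      moreover have "k - l + 2 \<le> k" using l d by simp
      ultimately show ?thesis using Suc.IH[of "k - l + 1"] Suc.IH[of "k - l + 2"] Suc.prems
        by (simp add: mult.commute)
    qed
    also have "\<dots> = fps_to_fls (gordon_tail k (Suc j) (k - d))"
    proof -
      let ?T = "gordon_tail k (Suc j) (k - d) :: 'a fps"
      have "fps_to_fls (gordon_tail k j (Suc d)) - fps_to_fls (gordon_tail k j d) =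
          fls_X ^ (Suc j * d) * fps_to_fls ?T"
        unfolding gordon_tail_Suc[OF d]
        by (simp add: fls_times_fps_to_fls fps_to_fls_power del: power_Suc mult_Suc)
      moreover have "fls_X ^ (Suc j * d) \<noteq> (0 :: 'a fls)" by simp
      ultimately show ?thesis using nonzero_mult_div_cancel_left by metis
    qed
    finally show ?thesis using l by simp
  qed
qed

section \<open>Entries of the matrix products and the decomposition\<close>

lemma gordon_A_prod_carrier: "gordon_A_prod k j \<in> carrier_mat k k"
  by (induction j) (auto simp: gordon_A_def)

lemma fps_to_fls_sum: "fps_to_fls (\<Sum>a\<in>A. f a) = (\<Sum>a\<in>A. fps_to_fls (f a))"
  by (induction A rule: infinite_finite_induct) (simp_all add: fps_to_fls_plus)

text \<open>Multiplying by one more matrix on the right is the recurrence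
  \<open>gordon_head_Suc\<close>.\<close>

lemma gordon_h_eq_gordon_head:
  assumes "j \<ge> 1" "1 \<le> i" "i \<le> k" "1 \<le> l" "l \<le> k"
  shows "gordon_h k j i l = (fps_to_fls (gordon_head k i j l) :: 'a::field_char_0 fls)"
  using assms(1,4,5)
proof (induction j arbitrary: l rule: nat_induct_at_least)
  {
    case base
    have "gordon_A_prod k 1 = (gordon_A k 1 :: 'a fls mat)"
      by (simp add: gordon_A_def)
    hence "gordon_h k 1 i l = (if i + l \<le> k + 1 then fls_X ^ (l - 1) else 0 :: 'a fls)"
      using assms base by (auto simp: gordon_h_def gordon_A_def)
    thus ?case using gordon_head_1[of l i k, where 'a = 'a] assms base by (simp add: fps_to_fls_power)
  next
    case (Suc j)
    have "gordon_h k (Suc j) i l =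
        (\<Sum>r<k. gordon_A_prod k j $$ (i - 1, r) * (gordon_A k (Suc j) $$ (r, l - 1) :: 'a fls))"
      using gordon_A_prod_carrier[of k j, where 'a = 'a] assms Suc.prems
      by (simp add: gordon_h_def gordon_A_def scalar_prod_def lessThan_atLeast0)
    \<comment> \<open>The matrix index \<open>r\<close> starts at 0, the index
      \<open>l' = Suc r\<close> at 1.\<close>
    also have "\<dots> = (\<Sum>l' = 1..k. gordon_h k j i l' * (if l' + l \<le> k + 1 then fls_X ^ ((l - 1) * Suc j) else 0))"
      using Suc.prems
      by (intro sum.reindex_bij_witness[of _ "\<lambda>l'. l' - 1" Suc]) (auto simp: gordon_h_def gordon_A_def)
    also have "\<dots> = (\<Sum>l' = 1..k. fps_to_fls (gordon_head k i j l' *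
        (if l' + l \<le> k + 1 then fps_X ^ ((l - 1) * Suc j) else 0)))"
      by (intro sum.cong refl) (simp add: Suc.IH fls_times_fps_to_fls fps_to_fls_power)
    also have "\<dots> = fps_to_fls (gordon_head k i (Suc j) l)"
      using Suc.prems Suc.hyps assms by (subst gordon_head_Suc) (auto simp: fps_to_fls_sum)
    finally show ?case .
  }
qed

text \<open>Each summand is a head times a tail and thus counts the partitions with
  \<open>l - 1\<close> parts \<open>j\<close>; summing over \<open>l\<close> recovers all partitions
  counted by \<open>gordon_G k i\<close>.\<close>

theorem theorem4p2:
  fixes k i j :: nat
  assumes "k \<ge> 2" and "j \<ge> 1" and "1 \<le> i" and "i \<le> k"
  shows "gordon_G k i =
           (\<Sum>l = 1..k. gordon_h k j i l * gordon_G k ((k - 1) * j + l) :: 'a::field_char_0 fls)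
    \<and> (\<forall>l\<in>{1..k}. gordon_h k j i l * gordon_G k ((k - 1) * j + l) =
           (gen_fun (\<lambda>ps. diff2_at_distance (k - 1) ps \<and> count_list ps 1 \<le> k - i
              \<and> count_list ps j = l - 1) :: 'a fls))
    \<and> gordon_G k i =
           (gen_fun (\<lambda>ps. diff2_at_distance (k - 1) ps \<and> count_list ps 1 \<le> k - i) :: 'a fls)"
proof -
  let ?P = "\<lambda>ps. diff2_at_distance (k - 1) ps \<and> count_list ps 1 \<le> k - i"
  have summand: "gordon_h k j i l * gordon_G k ((k - 1) * j + l) =
      (gen_fun (\<lambda>ps. diff2_at_distance (k - 1) ps \<and> count_list ps 1 \<le> k - i
              \<and> count_list ps j = l - 1) :: 'a fls)" if "l \<in> {1..k}" for l
    using that assms partition_fps_head_tail[of l k j i, where 'a = 'a]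
      gordon_G_eq_gordon_tail[of k l j, where 'a = 'a]
    by (simp add: gen_fun_eq gordon_h_eq_gordon_head fls_times_fps_to_fls)
  \<comment> \<open>At \<open>j = 0\<close> the condition on all parts is positivity, and
    \<open>count_list ps 1 < k + 1 - i\<close> is the bound \<open>k - i\<close>.\<close>
  have "partition_fps ?P = (gordon_tail k 0 (k + 1 - i) :: 'a fps)"
    unfolding gordon_tail_def
    using assms by (intro partition_fps_cong) (auto simp: is_partition_def intro: gr0I)
  hence G: "gordon_G k i = (gen_fun ?P :: 'a fls)"
    using gordon_G_eq_gordon_tail[of k i 0, where 'a = 'a] assms by (simp add: gen_fun_eq)
  also have "\<dots> = (\<Sum>l = 1..k. gen_fun (\<lambda>ps. diff2_at_distance (k - 1) ps \<and> count_list ps 1 \<le> k - i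
              \<and> count_list ps j = l - 1))"
    using assms partition_fps_sum_count[of k i j, where 'a = 'a]
    by (simp add: gen_fun_eq fps_to_fls_sum)
  also have "\<dots> = (\<Sum>l = 1..k. gordon_h k j i l * gordon_G k ((k - 1) * j + l))"
    by (rule sum.cong) (simp_all only: summand)
  finally show ?thesis using summand G by blast
qed

end
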